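(* Let $N\ge6$ and let $\mathscr C$ be a conic condition number on $\mathbb R^{N+1}$ whose set of ill-posed inputs $\Sigma$ is contained in the zero set of a homogeneous real polynomial of degree $d\ge1$. Let $\bar x\in\mathbb S^N$ with $C:=\mathscr C(\bar x)<\infty$ and let $\sigma>0$. Write $\epsilon:=1-e^{-\frac{1}{2\sigma^2}}$. Then $\mathbb E_{x\sim N(\bar x,\sigma^2\mathrm{Id})}\ln\mathscr C(x)\le H(N,d,\sigma,C)$, where $$\begin{aligned}H(N,d,\sigma,C)={}&\ln C\cdot\min\Big\{\epsilon,\ \frac{1}{(2C)^N}\Big(2^{N-1}+\frac{1}{\sigma^{N+1}}\Big)\Big\}\\ &+\min\Big\{\epsilon\ln C,\ 4\pi\sigma C\sqrt{N+1}\,\ln C,\ \frac{\epsilon}{N}\Big(\ln\Big(2^{N-1}+\frac{1}{\sigma^{N+1}}\Big)-\ln\epsilon\Big)\Big\}\\ &+\ln(Nd)\cdot\min\Big\{1,\ e^{-\frac{1}{2\sigma^2}}+4\pi C\sigma\sqrt{N+1}\Big\}+3\ln2+2 .\end{aligned}$$ Moreover $\lim_{\sigma\to0}H(N,d,\sigma,C)=\ln C+3\ln2+2$ and $\lim_{\sigma\to\infty}H(N,d,\sigma,C)=\ln(Nd)+3\ln2+2$.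
   Context: $\mathbb R^{N+1}$ carries the standard inner product and norm; $\mathbb S^N$ is its unit sphere. A conic condition number is a map $\mathscr C:\mathbb R^{N+1}\to[1,\infty]$, $\mathscr C(x)=\|x\|/d(x,\Sigma)$, where $\Sigma\neq\{0\}$ is a closed set closed under multiplication by real scalars ($d$ = Euclidean distance). $N(\bar x,\sigma^2\mathrm{Id})$ is the Gaussian on $\mathbb R^{N+1}$ with density $(2\pi\sigma^2)^{-(N+1)/2}\exp(-\|x-\bar x\|^2/(2\sigma^2))$. $\ln$ is the natural logarithm. *)

theory Defs
  imports "HOL-Analysis.Analysis"
begin

definition hom_poly_deg :: "nat \<Rightarrow> (real^'n \<Rightarrow> real) \<Rightarrow> bool" where
  "hom_poly_deg d p \<longleftrightarrow>
     (\<exists>c :: ('n \<Rightarrow> nat) \<Rightarrow> real.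
        (\<exists>\<alpha>. sum \<alpha> UNIV = d \<and> c \<alpha> \<noteq> 0) \<and>
        (\<forall>x. p x = (\<Sum>\<alpha>\<in>{\<alpha>. sum \<alpha> UNIV = d}. c \<alpha> * (\<Prod>i\<in>UNIV. (x $ i) ^ \<alpha> i))))"

definition cond_num :: "(real^'n) set \<Rightarrow> real^'n \<Rightarrow> ereal" where
  "cond_num S x = (if infdist x S = 0 then \<infinity> else ereal (norm x / infdist x S))"

definition ln_cond_num :: "(real^'n) set \<Rightarrow> real^'n \<Rightarrow> ennreal" where
  "ln_cond_num S x = (if cond_num S x = \<infinity> then \<infinity>
                      else ennreal (ln (real_of_ereal (cond_num S x))))"

definition gauss_density :: "real \<Rightarrow> real^'n \<Rightarrow> real^'n \<Rightarrow> real" where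
  "gauss_density \<sigma> xbar x =
     (2 * pi * \<sigma>\<^sup>2) powr (- real CARD('n) / 2) * exp (- (norm (x - xbar))\<^sup>2 / (2 * \<sigma>\<^sup>2))"

definition H_bound :: "nat \<Rightarrow> nat \<Rightarrow> real \<Rightarrow> real \<Rightarrow> real" where
  "H_bound N d \<sigma> C =
    (let \<epsilon> = 1 - exp (- 1 / (2 * \<sigma>\<^sup>2));
         A = 2 ^ (N - 1) + 1 / \<sigma> ^ (N + 1)
     in ln C * min \<epsilon> (A / (2 * C) ^ N)
        + min (\<epsilon> * ln C)
              (min (4 * pi * \<sigma> * C * sqrt (real N + 1) * ln C)
                   (\<epsilon> / real N * (ln A - ln \<epsilon>)))
        + ln (real N * real d) * min 1 (exp (- 1 / (2 * \<sigma>\<^sup>2)) + 4 * pi * C * \<sigma> * sqrt (real N + 1))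
        + 3 * ln 2 + 2)"

end

theory Submission
  imports Defs "HOL-Probability.Distributions" "HOL-Computational_Algebra.Fundamental_Theorem_Algebra"
    "HOL-Real_Asymp.Real_Asymp"
begin

text \<open>
  Let \<open>p\<close> be the form vanishing on \<open>\<Sigma>\<close>, and for a direction \<open>v\<close> let \<open>\<psi>(x, v)\<close> be the largest value of
  \<open>\<bar>t\<bar> powr (-1/2)\<close> over the complex roots \<open>t\<close> of \<open>p (x + t v)\<close>. If \<open>p\<close> vanishes at distance \<open>\<delta>\<close>
  from \<open>x\<close>, then the power series of \<open>1 / p\<close> at \<open>x\<close> diverges in that direction; its \<open>k\<close>-th term is a form
  of degree \<open>k\<close>, and such a form is on average over Gaussian directions not much smaller than at
  the given direction. As the radius of convergence along \<open>v\<close> is the smallest \<open>\<bar>t\<bar>\<close>, this bounds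
  \<open>\<delta> powr (-1/2)\<close> by a constant times the mean of \<open>\<psi>(x, v)\<close> over Gaussian \<open>v\<close>.
  For fixed \<open>v\<close>, the mean of \<open>\<psi>\<close> over Gaussian \<open>x\<close> is computed on lines parallel to \<open>v\<close>, where one only
  has to avoid at most \<open>d\<close> points of the complex plane. Together, the mean of
  \<open>dist (x, \<Sigma>) powr (-1/2)\<close> is at most \<open>4 sqrt (2 d sqrt (N + 1) / (\<pi> \<sigma>))\<close>, without tube
  formulas or integral geometry.

  Tangent lines of the logarithm convert this into two bounds for the mean of the logarithm of the condition
  number: a global one, and one for small \<open>\<sigma>\<close> in which the condition number is at most \<open>3 C\<close> on the ball of radius \<open>1 / (2 C)\<close> about the
  centre and Chebyshev's inequality outside. The bound \<open>H\<close> dominates the second if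
  \<open>2 C \<sigma> sqrt (N + 1) \<le> 1 / 2\<close> and the first otherwise.
\<close>

section \<open>One-dimensional Gaussian integrals\<close>

text \<open>This is the part of the singularity above its value at distance \<open>\<delta>\<close>.
  Only this part has to be paid for with the maximum of a density; the level
  \<open>1 / sqrt \<delta>\<close> costs just total mass. The cutoff stays free so that it can be
  optimised.\<close>

lemma nn_integral_truncated_inverse_sqrt:
  assumes d: "\<delta> > 0"
  shows "(\<integral>\<^sup>+ r. ennreal (max 0 (1 / sqrt \<bar>r\<bar> - 1 / sqrt \<delta>)) \<partial>lborel) = ennreal (2 * sqrt \<delta>)"
proof -
  define g where "g = (\<lambda>r::real. max 0 (1 / sqrt \<bar>r\<bar> - 1 / sqrt \<delta>))"
  have "((\<lambda>r. 1 / sqrt r - 1 / sqrt \<delta>) has_integral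
      (2 * sqrt \<delta> - \<delta> / sqrt \<delta>) - (2 * sqrt 0 - 0 / sqrt \<delta>)) {0..\<delta>}"
  proof (rule fundamental_theorem_of_calculus_interior)
    show "continuous_on {0..\<delta>} (\<lambda>r. 2 * sqrt r - r / sqrt \<delta>)"
      using d by (intro continuous_intros) auto
    fix r assume r: "r \<in> {0<..<\<delta>}"
    then have "((\<lambda>r. 2 * sqrt r - r / sqrt \<delta>) has_real_derivative 1 / sqrt r - 1 / sqrt \<delta>) (at r)"
      using d by (auto intro!: derivative_eq_intros simp: field_simps)
    then show "((\<lambda>r. 2 * sqrt r - r / sqrt \<delta>) has_vector_derivative 1 / sqrt r - 1 / sqrt \<delta>) (at r)"
      by (simp add: has_real_derivative_iff_has_vector_derivative)
  qed (use d in simp)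
  also have "(2 * sqrt \<delta> - \<delta> / sqrt \<delta>) - (2 * sqrt 0 - 0 / sqrt \<delta>) = sqrt \<delta>"
    using d by (simp add: real_div_sqrt)
  finally have I: "((\<lambda>r. 1 / sqrt r - 1 / sqrt \<delta>) has_integral sqrt \<delta>) {0..\<delta>}" .
  \<comment> \<open>At \<open>0\<close> the quotient \<open>1 / sqrt 0\<close> is \<open>0\<close>,
    so \<open>g 0 = 0\<close> differs from the integrand above; that point is dropped as a finite
    exceptional set.\<close>
  have pos: "(g has_integral sqrt \<delta>) {0..\<delta>}"
  proof (rule has_integral_spike_finite[OF _ _ I])
    show "g r = 1 / sqrt r - 1 / sqrt \<delta>" if "r \<in> {0..\<delta>} - {0}" for r
      using that d unfolding g_def by (simp add: max_def frac_le)
  qed simp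
  have "((\<lambda>r. g (- r)) has_integral sqrt \<delta>) {- \<delta>..- 0}"
    using pos by (subst has_integral_reflect_real) simp
  then have neg: "(g has_integral sqrt \<delta>) {- \<delta>..0}" by (simp add: g_def)
  have "(g has_integral sqrt \<delta> + sqrt \<delta>) {- \<delta>..\<delta>}"
    by (rule has_integral_combine[OF _ _ neg pos]) (use d in auto)
  then have "(g has_integral sqrt \<delta> + sqrt \<delta>) UNIV"
  proof (rule has_integral_on_superset)
    fix r assume "r \<notin> {- \<delta>..\<delta>}"
    then have "\<delta> \<le> \<bar>r\<bar>" by auto
    then have "1 / sqrt \<bar>r\<bar> \<le> 1 / sqrt \<delta>" using d by (intro frac_le) auto
    then show "g r = 0" by (simp add: g_def)
  qed simp
  then have "integral\<^sup>N lborel g = ennreal (sqrt \<delta> + sqrt \<delta>)"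
    by (intro nn_integral_has_integral_lborel) (auto simp: g_def)
  then show ?thesis unfolding g_def by simp
qed

lemma nn_integral_lborel_shift:
  fixes f :: "'a::euclidean_space \<Rightarrow> ennreal"
  assumes [measurable]: "f \<in> borel_measurable borel"
  shows "(\<integral>\<^sup>+ x. f (x + a) \<partial>lborel) = (\<integral>\<^sup>+ x. f x \<partial>lborel)"
proof -
  have "(\<integral>\<^sup>+ x. f x \<partial>lborel) = (\<integral>\<^sup>+ x. f x \<partial>distr lborel borel ((+) a))"
    by (simp add: lborel_distr_plus)
  also have "\<dots> = (\<integral>\<^sup>+ x. f (a + x) \<partial>lborel)"
    by (rule nn_integral_distr) auto
  finally show ?thesis by (simp add: add.commute)
qed

lemma nn_integral_normal_density:
  "\<sigma> > 0 \<Longrightarrow> (\<integral>\<^sup>+ r. ennreal (normal_density \<mu> \<sigma> r) \<partial>lborel) = 1"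
  by (simp add: nn_integral_eq_integral)

lemma normal_density_le:
  assumes "\<sigma> > 0"
  shows "normal_density \<mu> \<sigma> r \<le> 1 / (\<sigma> * sqrt (2 * pi))"
proof -
  have "normal_density \<mu> \<sigma> r \<le> 1 / sqrt (2 * pi * \<sigma>\<^sup>2) * 1"
    unfolding normal_density_def using assms by (intro mult_left_mono) auto
  then show ?thesis using assms by (simp add: real_sqrt_mult mult.commute)
qed

text \<open>Since the exponent \<open>1/2\<close> is smaller than \<open>1\<close>, the nearest of \<open>m\<close> points costs only a factor
  \<open>m powr (1/2)\<close>; taking logarithms, only \<open>ln d\<close> enters the final bound.\<close>

lemma normal_inverse_sqrt_dist_finite_set:
  fixes A :: "complex set"
  assumes s: "\<sigma> > 0" and fin: "finite A" and card: "card A \<le> m" and m: "m \<ge> 1"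
  shows "(\<integral>\<^sup>+ r. ennreal (normal_density \<mu> \<sigma> r)
            * (SUP a\<in>A. inverse (ennreal (sqrt (cmod (complex_of_real r - a))))) \<partial>lborel)
         \<le> ennreal (2 * sqrt (2 * real m / (\<sigma> * sqrt (2 * pi))))"
proof -
  define M where "M = 1 / (\<sigma> * sqrt (2 * pi))"
  have M: "M > 0" using s by (simp add: M_def)
  \<comment> \<open>With \<open>M\<close> the maximum of the density, the final estimate is
    \<open>1 / sqrt \<delta> + 2 m M sqrt \<delta>\<close>. This cutoff minimises it and makes the
    two terms equal.\<close>
  define \<delta> where "\<delta> = 1 / (2 * real m * M)"
  have d: "\<delta> > 0" using M m by (simp add: \<delta>_def)
  define g where "g = (\<lambda>r::real. max 0 (1 / sqrt \<bar>r\<bar> - 1 / sqrt \<delta>))"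
  have g0: "g r \<ge> 0" for r by (simp add: g_def)
  have [measurable]: "g \<in> borel_measurable borel" by (simp add: g_def)
  \<comment> \<open>The distance from \<open>r\<close> to \<open>a\<close> is at least that to
    \<open>Re a\<close>, so non-real points cost no more than real ones. The finitely many
    \<open>r\<close> at which the latter distance vanishes are ignored.\<close>
  have "finite (Re ` A)" using fin by simp
  then have "AE r in lborel. r \<notin> Re ` A"
    by (intro AE_not_in finite_imp_null_set_lborel)
  then have "AE r in lborel. ennreal (normal_density \<mu> \<sigma> r)
            * (SUP a\<in>A. inverse (ennreal (sqrt (cmod (complex_of_real r - a)))))
        \<le> ennreal (normal_density \<mu> \<sigma> r) * ennreal (1 / sqrt \<delta>)
          + (\<Sum>a\<in>A. ennreal M * ennreal (g (r - Re a)))"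
  proof eventually_elim
    case (elim r)
    have "(SUP a\<in>A. inverse (ennreal (sqrt (cmod (complex_of_real r - a)))))
        \<le> ennreal (1 / sqrt \<delta> + (\<Sum>a\<in>A. g (r - Re a)))"
    proof (rule SUP_least)
      fix a assume a: "a \<in> A"
      have ne: "r - Re a \<noteq> 0" using elim a by auto
      have le: "\<bar>r - Re a\<bar> \<le> cmod (complex_of_real r - a)"
        using abs_Re_le_cmod[of "complex_of_real r - a"] by simp
      have pos: "sqrt (cmod (complex_of_real r - a)) > 0" using ne le by auto
      then have "inverse (ennreal (sqrt (cmod (complex_of_real r - a))))
          = ennreal (1 / sqrt (cmod (complex_of_real r - a)))"
        by (simp add: inverse_ennreal divide_inverse)
      also have "1 / sqrt (cmod (complex_of_real r - a)) \<le> 1 / sqrt \<bar>r - Re a\<bar>"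
        using ne le by (intro frac_le) auto
      also have "\<dots> \<le> 1 / sqrt \<delta> + g (r - Re a)" by (simp add: g_def)
      also have "\<dots> \<le> 1 / sqrt \<delta> + (\<Sum>a\<in>A. g (r - Re a))"
        using member_le_sum[of a A "\<lambda>a. g (r - Re a)"] a fin g0 by auto
      finally show "inverse (ennreal (sqrt (cmod (complex_of_real r - a))))
          \<le> ennreal (1 / sqrt \<delta> + (\<Sum>a\<in>A. g (r - Re a)))"
        by (simp add: ennreal_leI)
    qed
    then have "ennreal (normal_density \<mu> \<sigma> r)
            * (SUP a\<in>A. inverse (ennreal (sqrt (cmod (complex_of_real r - a)))))
        \<le> ennreal (normal_density \<mu> \<sigma> r) * ennreal (1 / sqrt \<delta> + (\<Sum>a\<in>A. g (r - Re a)))"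
      by (rule mult_left_mono) simp
    also have "\<dots> = ennreal (normal_density \<mu> \<sigma> r) * ennreal (1 / sqrt \<delta>)
        + ennreal (normal_density \<mu> \<sigma> r) * (\<Sum>a\<in>A. ennreal (g (r - Re a)))"
      using d g0 by (simp add: ennreal_plus sum_nonneg distrib_left sum_ennreal)
    also have "\<dots> \<le> ennreal (normal_density \<mu> \<sigma> r) * ennreal (1 / sqrt \<delta>)
        + ennreal M * (\<Sum>a\<in>A. ennreal (g (r - Re a)))"
      using normal_density_le[OF s, of \<mu> r]
      by (intro add_left_mono mult_right_mono ennreal_leI) (auto simp: M_def)
    finally show ?case by (simp add: sum_distrib_left)
  qed
  then have "(\<integral>\<^sup>+ r. ennreal (normal_density \<mu> \<sigma> r)
            * (SUP a\<in>A. inverse (ennreal (sqrt (cmod (complex_of_real r - a))))) \<partial>lborel)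
      \<le> (\<integral>\<^sup>+ r. ennreal (normal_density \<mu> \<sigma> r) * ennreal (1 / sqrt \<delta>)
          + (\<Sum>a\<in>A. ennreal M * ennreal (g (r - Re a))) \<partial>lborel)"
    by (rule nn_integral_mono_AE)
  also have "\<dots> = ennreal (1 / sqrt \<delta>) + (\<Sum>a\<in>A. ennreal M * ennreal (2 * sqrt \<delta>))"
  proof -
    have "(\<integral>\<^sup>+ r. ennreal (g (r - Re a)) \<partial>lborel) = ennreal (2 * sqrt \<delta>)" for a
      using nn_integral_lborel_shift[of "\<lambda>r. ennreal (g r)" "- Re a"]
        nn_integral_truncated_inverse_sqrt[OF d] by (simp add: g_def)
    then show ?thesis
      by (simp add: nn_integral_add nn_integral_sum nn_integral_cmult nn_integral_multc
          nn_integral_normal_density[OF s])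
  qed
  also have "\<dots> = ennreal (1 / sqrt \<delta> + real (card A) * (M * (2 * sqrt \<delta>)))"
    using M d by (simp add: ennreal_mult'[symmetric] ennreal_plus ennreal_of_nat_eq_real_of_nat)
  also have "\<dots> \<le> ennreal (1 / sqrt \<delta> + real m * (M * (2 * sqrt \<delta>)))"
    using M d card by (intro ennreal_leI add_left_mono mult_right_mono) auto
  also have "1 / sqrt \<delta> + real m * (M * (2 * sqrt \<delta>)) = 2 * sqrt (2 * real m * M)"
  proof -
    have "real m * (M * (2 * sqrt \<delta>)) = sqrt \<delta> / \<delta>"
      using M m by (simp add: \<delta>_def)
    also have "\<dots> = 1 / sqrt \<delta>" using d by (simp add: field_simps)
    finally show ?thesis by (simp add: \<delta>_def real_sqrt_divide)
  qed
  finally show ?thesis by (simp add: M_def)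
qed

lemma nn_integral_normal_second_moment:
  assumes s: "\<sigma> > 0"
  shows "(\<integral>\<^sup>+ t. ennreal (normal_density \<mu> \<sigma> t * (t - a)\<^sup>2) \<partial>lborel) = ennreal (\<sigma>\<^sup>2 + (\<mu> - a)\<^sup>2)"
proof -
  have eq: "normal_density \<mu> \<sigma> t * (t - a)\<^sup>2 = normal_density \<mu> \<sigma> t * (t - \<mu>)\<^sup>2
      + (\<mu> - a)\<^sup>2 * normal_density \<mu> \<sigma> t + 2 * (\<mu> - a) * (normal_density \<mu> \<sigma> t * (t - \<mu>))" for t
    by (simp add: power2_eq_square algebra_simps)
  have "has_bochner_integral lborel (\<lambda>t. normal_density \<mu> \<sigma> t * (t - \<mu>)\<^sup>2
      + (\<mu> - a)\<^sup>2 * normal_density \<mu> \<sigma> t + 2 * (\<mu> - a) * (normal_density \<mu> \<sigma> t * (t - \<mu>)))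
      (\<sigma>\<^sup>2 + (\<mu> - a)\<^sup>2 * 1 + 2 * (\<mu> - a) * 0)"
  proof (intro has_bochner_integral_add has_bochner_integral_mult_right)
    show "has_bochner_integral lborel (\<lambda>t. normal_density \<mu> \<sigma> t * (t - \<mu>)\<^sup>2) (\<sigma>\<^sup>2)"
      using normal_moment_even[OF s, of \<mu> 1] by (simp add: numeral_2_eq_2)
    show "has_bochner_integral lborel (normal_density \<mu> \<sigma>) 1"
      using s by (simp add: has_bochner_integral_iff)
    show "has_bochner_integral lborel (\<lambda>t. normal_density \<mu> \<sigma> t * (t - \<mu>)) 0"
      using normal_moment_odd[OF s, of \<mu> 0] by simp
  qed
  then have "has_bochner_integral lborel (\<lambda>t. normal_density \<mu> \<sigma> t * (t - a)\<^sup>2) (\<sigma>\<^sup>2 + (\<mu> - a)\<^sup>2)"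
    by (simp add: eq)
  then show ?thesis
    by (auto simp: has_bochner_integral_iff nn_integral_eq_integral)
qed

section \<open>Reciprocals of complex polynomials\<close>

text \<open>Normalising by the constant term makes the entries of \<open>bs\<close> the reciprocals
  of the roots, with multiplicity. In this form the reciprocal power series is a product of
  geometric series.\<close>

lemma poly_factor_unit_constant:
  fixes Q :: "complex poly"
  assumes "poly Q 0 \<noteq> 0"
  shows "\<exists>bs. length bs = degree Q \<and> Q = smult (poly Q 0) (\<Prod>b\<leftarrow>bs. [:1, - b:])"
  using assms
proof (induction "degree Q" arbitrary: Q)
  case 0
  then obtain c where "Q = [:c:]" by (metis degree_eq_zeroE)
  then show ?case by (intro exI[of _ "[]"]) simp
next
  case (Suc m)
  have "\<not> constant (poly Q)"
    using Suc.hyps(2) by (simp add: constant_degree)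
  then obtain z where z: "poly Q z = 0"
    using fundamental_theorem_of_algebra by blast
  with Suc.prems have z0: "z \<noteq> 0" by auto
  from z obtain R where R: "Q = [:- z, 1:] * R"
    by (metis dvdE poly_eq_0_iff_dvd)
  have R0: "poly R 0 \<noteq> 0" using Suc.prems R by auto
  then have "R \<noteq> 0" by auto
  then have "degree Q = Suc (degree R)"
    unfolding R by (subst degree_mult_eq) auto
  with Suc.hyps(2) have m: "m = degree R" by simp
  obtain bs where bs: "length bs = degree R" "R = smult (poly R 0) (\<Prod>b\<leftarrow>bs. [:1, - b:])"
    using Suc.hyps(1)[OF m R0] by blast
  have lin: "[:- z, 1:] = smult (- z) [:1, - (1 / z):]" using z0 by simp
  have "Q = [:- z, 1:] * smult (poly R 0) (\<Prod>b\<leftarrow>bs. [:1, - b:])"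
    using R bs(2) by simp
  also have "\<dots> = smult (- z * poly R 0) (\<Prod>b\<leftarrow>(1/z) # bs. [:1, - b:])"
    unfolding lin by (simp only: list.map prod_list.Cons mult_smult_left mult_smult_right smult_smult mult.commute[of "poly R 0"])
  also have "- z * poly R 0 = poly Q 0" by (simp add: R)
  finally show ?case
    using bs(1) m Suc.hyps(2) by (intro exI[of _ "(1/z) # bs"]) simp
qed

lemma inverse_fps_linear:
  fixes b :: complex
  shows "inverse (fps_of_poly [:1, - b:]) = Abs_fps (\<lambda>k. b ^ k)"
proof (rule fps_inverse_unique)
  have "fps_of_poly [:1, - b:] = 1 - fps_X * fps_const b"
    by (simp add: fps_of_poly_pCons fps_const_neg[symmetric] del: fps_const_neg)
  moreover have "(1 - fps_X * fps_const b) * Abs_fps (\<lambda>k. b ^ k) = 1"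
    by (rule fps_ext) (simp add: algebra_simps mult.assoc, case_tac n, simp_all)
  ultimately show "fps_of_poly [:1, - b:] * Abs_fps (\<lambda>k. b ^ k) = 1" by metis
qed

text \<open>Every further geometric series adds one convolution, whose \<open>k + 1\<close> summands
  are each of order \<open>R ^ i * R ^ (k - i)\<close>. The resulting factor is polynomial in
  \<open>k\<close> and disappears under \<open>k\<close>-th roots.\<close>

lemma inverse_fps_prod_bound:
  fixes bs :: "complex list"
  assumes "\<forall>b\<in>set bs. norm b \<le> R" and R: "R \<ge> 0"
  shows "norm (fps_nth (inverse (fps_of_poly (\<Prod>b\<leftarrow>bs. [:1, - b:]))) k)
           \<le> real (Suc k) ^ length bs * R ^ k"
  using assms(1)
proof (induction bs arbitrary: k)
  case Nil
  then show ?case using R by (cases k) auto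
next
  case (Cons b bs)
  define F where "F = inverse (fps_of_poly (\<Prod>b\<leftarrow>bs. [:1, - b:]))"
  have IH: "norm (fps_nth F j) \<le> real (Suc j) ^ length bs * R ^ j" for j
    using Cons unfolding F_def by auto
  have b: "norm b \<le> R" using Cons.prems by simp
  have "inverse (fps_of_poly (\<Prod>b\<leftarrow>b # bs. [:1, - b:])) = Abs_fps (\<lambda>k. b ^ k) * F"
    unfolding F_def list.map prod_list.Cons fps_of_poly_mult fps_inverse_mult inverse_fps_linear ..
  then have "norm (fps_nth (inverse (fps_of_poly (\<Prod>b\<leftarrow>b # bs. [:1, - b:]))) k)
      = norm (\<Sum>i=0..k. b ^ i * fps_nth F (k - i))"
    by (simp add: fps_mult_nth)
  also have "\<dots> \<le> (\<Sum>i=0..k. real (Suc k) ^ length bs * R ^ k)"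
  proof (rule sum_norm_le)
    fix i assume i: "i \<in> {0..k}"
    have "norm (b ^ i * fps_nth F (k - i)) \<le> R ^ i * (real (Suc (k - i)) ^ length bs * R ^ (k - i))"
      unfolding norm_mult norm_power using b IH R by (intro mult_mono power_mono) auto
    also have "\<dots> \<le> R ^ i * (real (Suc k) ^ length bs * R ^ (k - i))"
      using R by (intro mult_left_mono mult_right_mono power_mono) auto
    also have "\<dots> = real (Suc k) ^ length bs * R ^ k"
      using i by (simp add: power_add[symmetric])
    finally show "norm (b ^ i * fps_nth F (k - i)) \<le> real (Suc k) ^ length bs * R ^ k" .
  qed
  also have "\<dots> = real (Suc k) ^ length (b # bs) * R ^ k" by simp
  finally show ?case .
qed

text \<open>A non-zero \<open>b\<close> in the factorisation is the reciprocal of a root and so has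
  modulus at most \<open>R\<close>. The condition on the roots is multiplied out in order to admit
  \<open>R = 0\<close>, the case of no roots.\<close>

lemma inverse_fps_poly_bound:
  fixes Q :: "complex poly"
  assumes Q0: "poly Q 0 \<noteq> 0" and R: "R \<ge> 0" and deg: "degree Q \<le> d"
    and roots: "\<And>t. poly Q t = 0 \<Longrightarrow> 1 \<le> R * cmod t"
  shows "cmod (poly Q 0) * cmod (fps_nth (inverse (fps_of_poly Q)) k) \<le> real (Suc k) ^ d * R ^ k"
proof -
  obtain bs where bs: "length bs = degree Q" "Q = smult (poly Q 0) (\<Prod>b\<leftarrow>bs. [:1, - b:])"
    using poly_factor_unit_constant[OF Q0] by blast
  have "norm b \<le> R" if b: "b \<in> set bs" for b
  proof (cases "b = 0")
    case False
    have "poly (\<Prod>b\<leftarrow>bs. [:1, - b:]) (1 / b) = 0"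
      using b False by (induction bs) (auto)
    then have "poly Q (1 / b) = 0" by (subst bs(2)) simp
    from roots[OF this] show ?thesis using False by (simp add: norm_divide field_simps)
  qed (use R in simp)
  then have "norm (fps_nth (inverse (fps_of_poly (\<Prod>b\<leftarrow>bs. [:1, - b:]))) k)
      \<le> real (Suc k) ^ length bs * R ^ k"
    by (intro inverse_fps_prod_bound R) auto
  also have "\<dots> \<le> real (Suc k) ^ d * R ^ k"
    using bs(1) deg R by (intro mult_right_mono power_increasing) auto
  finally have "norm (fps_nth (inverse (fps_of_poly (\<Prod>b\<leftarrow>bs. [:1, - b:]))) k)
    \<le> real (Suc k) ^ d * R ^ k" .
  moreover have "inverse (fps_of_poly Q) = fps_const (inverse (poly Q 0))
      * inverse (fps_of_poly (\<Prod>b\<leftarrow>bs. [:1, - b:]))"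
    by (subst bs(2)) (simp add: fps_of_poly_smult fps_inverse_mult fps_const_inverse)
  ultimately show ?thesis using Q0
    by (simp add: norm_mult norm_inverse mult.assoc[symmetric])
qed

section \<open>Taylor coefficients of a reciprocal\<close>

lemma inverse_fps_recursion:
  fixes f :: "complex fps"
  assumes "fps_nth f 0 \<noteq> 0" "k > 0"
  shows "fps_nth (inverse f) k
    = - (\<Sum>i=1..k. fps_nth f i * fps_nth (inverse f) (k - i)) / fps_nth f 0"
proof -
  have "0 = fps_nth (f * inverse f) k"
    using assms by (simp add: inverse_mult_eq_1')
  also have "\<dots> = (\<Sum>i=0..k. fps_nth f i * fps_nth (inverse f) (k - i))"
    by (simp add: fps_mult_nth)
  also have "\<dots> = fps_nth f 0 * fps_nth (inverse f) k
      + (\<Sum>i=1..k. fps_nth f i * fps_nth (inverse f) (k - i))"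
    by (subst sum.atLeast_Suc_atMost) auto
  finally show ?thesis using assms(1) by (simp add: field_simps eq_neg_iff_add_eq_0)
qed

text \<open>The outer variable of \<open>P\<close> runs along the line, the inner one
  \<open>l\<close> is a parameter of the direction. As \<open>coeff P 0\<close> is a constant, the
  recursion for the reciprocal divides by no polynomial in \<open>l\<close>, and degrees add up as
  \<open>i + (k - i)\<close>.\<close>

lemma inverse_fps_coeff_polynomial:
  fixes P :: "complex poly poly"
  assumes deg: "\<And>j. degree (coeff P j) \<le> j" and c0: "coeff (coeff P 0) 0 \<noteq> 0"
  shows "\<exists>h. degree h \<le> k \<and>
    (\<forall>l. poly h l = fps_nth (inverse (fps_of_poly (map_poly (\<lambda>q. poly q l) P))) k)"
proof (induction k rule: less_induct)
  case (less k)
  have nth: "fps_nth (fps_of_poly (map_poly (\<lambda>q. poly q l) P)) j = poly (coeff P j) l" for l j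
    by (simp add: coeff_map_poly)
  have P0: "poly (coeff P 0) l = coeff (coeff P 0) 0" for l
    using deg[of 0] by (metis degree_eq_zeroE le_zero_eq coeff_pCons_0 poly_const_conv)
  show ?case
  proof (cases "k = 0")
    case True
    show ?thesis
      by (rule exI[of _ "[:inverse (coeff (coeff P 0) 0):]"]) (simp add: True P0 coeff_map_poly)
  next
    case False
    have "\<forall>i\<in>{1..k}. \<exists>h. degree h \<le> k - i \<and>
      (\<forall>l. poly h l = fps_nth (inverse (fps_of_poly (map_poly (\<lambda>q. poly q l) P))) (k - i))"
      using less False by auto
    then obtain h where h: "\<And>i. i \<in> {1..k} \<Longrightarrow> degree (h i) \<le> k - i"
      "\<And>i l. i \<in> {1..k} \<Longrightarrow>
        poly (h i) l = fps_nth (inverse (fps_of_poly (map_poly (\<lambda>q. poly q l) P))) (k - i)"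
      by metis
    define H where "H = smult (- inverse (coeff (coeff P 0) 0)) (\<Sum>i=1..k. coeff P i * h i)"
    have "degree (\<Sum>i=1..k. coeff P i * h i) \<le> k"
    proof (rule degree_sum_le)
      fix i assume i: "i \<in> {1..k}"
      have "degree (coeff P i * h i) \<le> degree (coeff P i) + degree (h i)" by (rule degree_mult_le)
      also have "\<dots> \<le> i + (k - i)" using deg h(1)[OF i] by (intro add_mono)
      finally show "degree (coeff P i * h i) \<le> k" using i by simp
    qed simp
    then have "degree H \<le> k" unfolding H_def by (metis degree_smult_le order_trans)
    moreover have "poly H l = fps_nth (inverse (fps_of_poly (map_poly (\<lambda>q. poly q l) P))) k" for l
      using False c0 unfolding H_def
      by (subst inverse_fps_recursion) (auto simp: nth P0 poly_sum h(2) divide_inverse coeff_map_poly)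
    ultimately show ?thesis by blast
  qed
qed

text \<open>Such coefficients give the reciprocal series a radius of convergence of at least
  \<open>1 / R\<close>. Inside that disc its product with \<open>Q\<close> is \<open>1\<close>,
  which excludes zeros of \<open>Q\<close>.\<close>

lemma inverse_fps_no_geometric_bound:
  fixes Q :: "complex poly"
  assumes Q0: "poly Q 0 \<noteq> 0" and root: "poly Q z = 0"
    and bound: "\<And>k. cmod (fps_nth (inverse (fps_of_poly Q)) k) \<le> K * real (Suc k) ^ d * R ^ k"
    and R: "R \<ge> 0"
  shows "R * cmod z \<ge> 1"
proof (rule ccontr)
  assume "\<not> R * cmod z \<ge> 1"
  then have Rz: "R * cmod z < 1" by simp
  define F where "F = inverse (fps_of_poly Q)"
  define r where "r = (R * cmod z + 1) / 2"
  have z0: "z \<noteq> 0" using Q0 root by auto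
  then have cz: "cmod z > 0" by simp
  have "r < 1" using Rz by (simp add: r_def)
  have r: "R * cmod z < r" "r > 0" using Rz R cz by (auto simp: r_def add_nonneg_pos)
  \<comment> \<open>For \<open>R > 0\<close>, \<open>w\<close> lies strictly between
    \<open>cmod z\<close> and \<open>1 / R\<close>. For \<open>R = 0\<close> it carries no
    information; there the reciprocal is a constant series and converges everywhere.\<close>
  define w where "w = (r / R)"
  show False
  proof (cases "R = 0")
    case True
    have Fk: "fps_nth F k = 0" if "k > 0" for k
      using bound[of k] that True unfolding F_def by (simp add: power_0_left)
    have "F = fps_const (fps_nth F 0)" by (rule fps_ext) (auto simp: Fk)
    then have "fps_conv_radius F = \<infinity>" by (metis fps_conv_radius_const)
    then have "eval_fps (F * fps_of_poly Q) z = eval_fps F z * eval_fps (fps_of_poly Q) z"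
      by (intro eval_fps_mult) auto
    moreover have "F * fps_of_poly Q = 1" unfolding F_def using Q0
      by (intro inverse_mult_eq_1) (simp add: poly_0_coeff_0)
    ultimately show False using root by simp
  next
    case False
    then have Rpos: "R > 0" using R by simp
    then have w: "w > 0" using r by (simp add: w_def)
    have "summable (\<lambda>k. fps_nth F k * of_real w ^ k)"
    proof (rule summable_comparison_test')
      \<comment> \<open>Root test: the \<open>k\<close>-th root of the polynomial factor tends to
        \<open>1\<close>, which leaves \<open>r < 1\<close>.\<close>
      have sm: "summable (\<lambda>k. real (Suc k) ^ d * r ^ k)"
      proof (rule summable_norm_cancel, rule root_test_convergence[where x=r])
        have "(\<lambda>k. ((1 + real k) powr (1 / real k)) ^ d * r) \<longlonglongrightarrow> 1 ^ d * r"
          by (intro tendsto_intros) real_asymp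
        moreover have "\<forall>\<^sub>F k in sequentially. ((1 + real k) powr (1 / real k)) ^ d * r
            = root k (norm (norm (real (Suc k) ^ d * r ^ k)))"
          using eventually_gt_at_top[of 0]
        proof eventually_elim
          case (elim k)
          have "root k (real (Suc k) ^ d * r ^ k) = root k (real (Suc k)) ^ d * r"
            using elim r by (simp add: real_root_mult real_root_power real_root_power_cancel del: of_nat_Suc)
          then show ?case using elim r
            by (simp add: abs_mult root_powr_inverse)
        qed
        ultimately show "(\<lambda>k. root k (norm (norm (real (Suc k) ^ d * r ^ k)))) \<longlonglongrightarrow> r"
          by (auto intro: Lim_transform_eventually)
      qed fact
      show "summable (\<lambda>k. K * (real (Suc k) ^ d * r ^ k))" by (rule summable_mult[OF sm])
      show "norm (fps_nth F k * of_real w ^ k) \<le> K * (real (Suc k) ^ d * r ^ k)" if "k \<ge> 0" for k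
      proof -
        have "norm (fps_nth F k * of_real w ^ k) = norm (fps_nth F k) * w ^ k"
          using w by (simp add: norm_mult norm_power)
        also have "\<dots> \<le> (K * real (Suc k) ^ d * R ^ k) * w ^ k"
          using bound[of k] w unfolding F_def by (intro mult_right_mono) auto
        also have "\<dots> = K * (real (Suc k) ^ d * r ^ k)"
          using Rpos by (simp add: w_def power_divide)
        finally show ?thesis .
      qed
    qed
    then have "conv_radius (fps_nth F) \<ge> norm (of_real w :: complex)"
      by (rule conv_radius_geI)
    moreover have "cmod z < w" using r Rpos by (simp add: w_def field_simps)
    ultimately have "ereal (cmod z) < fps_conv_radius F"
      unfolding fps_conv_radius_def
      using w by (auto intro: less_le_trans[of "ereal (cmod z)" "ereal w"])
    then have "eval_fps (F * fps_of_poly Q) z = eval_fps F z * eval_fps (fps_of_poly Q) z"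
      by (intro eval_fps_mult) auto
    moreover have "F * fps_of_poly Q = 1" unfolding F_def using Q0
      by (intro inverse_mult_eq_1) (simp add: poly_0_coeff_0)
    ultimately show False using root by simp
  qed
qed

section \<open>Gaussian vectors\<close>

lemma power2_norm_eq_sum_Basis:
  fixes x :: "'a::euclidean_space"
  shows "(norm x)\<^sup>2 = (\<Sum>b\<in>Basis. (x \<bullet> b)\<^sup>2)"
  unfolding power2_norm_eq_inner by (subst euclidean_inner) (simp add: power2_eq_square)

lemma gauss_density_eq_prod:
  fixes c x :: "real^'n"
  assumes s: "\<sigma> > 0"
  shows "gauss_density \<sigma> c x = (\<Prod>b\<in>Basis. normal_density (c \<bullet> b) \<sigma> (x \<bullet> b))"
proof -
  have "(\<Prod>b\<in>Basis. normal_density (c \<bullet> b) \<sigma> (x \<bullet> b))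
      = (1 / sqrt (2 * pi * \<sigma>\<^sup>2)) ^ CARD('n)
        * exp (\<Sum>b\<in>(Basis :: (real^'n) set). - (x \<bullet> b - c \<bullet> b)\<^sup>2 / (2 * \<sigma>\<^sup>2))"
    unfolding normal_density_def prod.distrib exp_sum[OF finite_Basis] by simp
  also have "(\<Sum>b\<in>(Basis :: (real^'n) set). - (x \<bullet> b - c \<bullet> b)\<^sup>2 / (2 * \<sigma>\<^sup>2))
      = - (norm (x - c))\<^sup>2 / (2 * \<sigma>\<^sup>2)"
    unfolding power2_norm_eq_sum_Basis
    by (simp add: sum_negf sum_divide_distrib inner_diff_left)
  also have "(1 / sqrt (2 * pi * \<sigma>\<^sup>2)) ^ CARD('n) = (2 * pi * \<sigma>\<^sup>2) powr (- real CARD('n) / 2)"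
  proof -
    have "1 / sqrt (2 * pi * \<sigma>\<^sup>2) = (2 * pi * \<sigma>\<^sup>2) powr (- (1 / 2))"
      unfolding powr_minus_divide by (subst powr_half_sqrt) auto
    then have "(1 / sqrt (2 * pi * \<sigma>\<^sup>2)) ^ CARD('n)
        = ((2 * pi * \<sigma>\<^sup>2) powr (- (1 / 2))) powr real CARD('n)"
      using s by (simp add: powr_realpow)
    then show ?thesis by (simp add: powr_powr)
  qed
  finally show ?thesis by (simp add: gauss_density_def)
qed

lemma gauss_density_pos: "\<sigma> > 0 \<Longrightarrow> gauss_density \<sigma> c x > 0"
  by (simp add: gauss_density_def)

lemma gauss_density_nonneg: "gauss_density \<sigma> c x \<ge> 0"
  by (simp add: gauss_density_def)

lemma borel_measurable_gauss_density [measurable]: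
  "gauss_density \<sigma> c \<in> borel_measurable borel"
  unfolding gauss_density_def [abs_def]
  by measurable

lemma nn_integral_gauss_density:
  fixes c :: "real^'n"
  assumes s: "\<sigma> > 0"
  shows "(\<integral>\<^sup>+ x. ennreal (gauss_density \<sigma> c x) \<partial>lborel) = 1"
proof -
  have "(\<integral>\<^sup>+ x. ennreal (gauss_density \<sigma> c x) \<partial>lborel)
      = (\<integral>\<^sup>+ x. (\<Prod>b\<in>Basis. ennreal (normal_density (c \<bullet> b) \<sigma> (x \<bullet> b))) \<partial>lborel)"
    by (simp add: gauss_density_eq_prod[OF s] prod_ennreal)
  also have "\<dots> = (\<Prod>b\<in>Basis. (\<integral>\<^sup>+ t. ennreal (normal_density (c \<bullet> b) \<sigma> t) \<partial>lborel))"
    by (rule nn_integral_lborel_prod) auto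
  finally show ?thesis by (simp add: nn_integral_normal_density[OF s])
qed

lemma nn_integral_gauss_second_moment:
  fixes c a :: "real^'n"
  assumes s: "\<sigma> > 0"
  shows "(\<integral>\<^sup>+ x. ennreal (gauss_density \<sigma> c x * (norm (x - a))\<^sup>2) \<partial>lborel)
    = ennreal (real CARD('n) * \<sigma>\<^sup>2 + (norm (c - a))\<^sup>2)"
proof -
  have coord: "(\<integral>\<^sup>+ x. ennreal (gauss_density \<sigma> c x * ((x - a) \<bullet> e)\<^sup>2) \<partial>lborel)
      = ennreal (\<sigma>\<^sup>2 + ((c - a) \<bullet> e)\<^sup>2)" if e: "e \<in> Basis" for e :: "real^'n"
  proof -
    define f where "f = (\<lambda>b t. ennreal (normal_density (c \<bullet> b) \<sigma> t
        * (if b = e then (t - a \<bullet> e)\<^sup>2 else 1)))"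
    have eq: "ennreal (gauss_density \<sigma> c x * ((x - a) \<bullet> e)\<^sup>2) = (\<Prod>b\<in>Basis. f b (x \<bullet> b))" for x
    proof -
      have "(\<Prod>b\<in>Basis. f b (x \<bullet> b)) = ennreal (\<Prod>b\<in>Basis. normal_density (c \<bullet> b) \<sigma> (x \<bullet> b)
          * (if b = e then (x \<bullet> b - a \<bullet> e)\<^sup>2 else 1))"
        unfolding f_def by (rule prod_ennreal) simp
      also have "\<dots> = ennreal (gauss_density \<sigma> c x * (x \<bullet> e - a \<bullet> e)\<^sup>2)"
        using e by (simp add: prod.distrib gauss_density_eq_prod[OF s] prod.delta)
      finally show ?thesis by (simp add: inner_diff_left)
    qed
    have "(\<integral>\<^sup>+ x. ennreal (gauss_density \<sigma> c x * ((x - a) \<bullet> e)\<^sup>2) \<partial>lborel)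
        = (\<Prod>b\<in>Basis. (\<integral>\<^sup>+ t. f b t \<partial>lborel))"
      unfolding eq by (rule nn_integral_lborel_prod) (auto simp: f_def)
    also have "\<dots> = (\<Prod>b\<in>Basis. if b = e then ennreal (\<sigma>\<^sup>2 + (c \<bullet> e - a \<bullet> e)\<^sup>2) else 1)"
      by (rule prod.cong)
        (auto simp: f_def nn_integral_normal_density[OF s] nn_integral_normal_second_moment[OF s])
    finally show ?thesis using e by (simp add: inner_diff_left)
  qed
  have eq: "ennreal (gauss_density \<sigma> c x * (norm (x - a))\<^sup>2)
      = (\<Sum>e\<in>Basis. ennreal (gauss_density \<sigma> c x * ((x - a) \<bullet> e)\<^sup>2))" for x
    unfolding power2_norm_eq_sum_Basis
    by (subst sum_ennreal) (auto simp: gauss_density_nonneg sum_distrib_left)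
  have "(\<integral>\<^sup>+ x. ennreal (gauss_density \<sigma> c x * (norm (x - a))\<^sup>2) \<partial>lborel)
      = (\<Sum>e\<in>Basis. ennreal (\<sigma>\<^sup>2 + ((c - a) \<bullet> e)\<^sup>2))"
    unfolding eq by (subst nn_integral_sum) (simp_all add: coord)
  also have "\<dots> = ennreal (\<Sum>e\<in>(Basis :: (real^'n) set). \<sigma>\<^sup>2 + ((c - a) \<bullet> e)\<^sup>2)"
    by (rule sum_ennreal) simp
  also have "(\<Sum>e\<in>(Basis :: (real^'n) set). \<sigma>\<^sup>2 + ((c - a) \<bullet> e)\<^sup>2)
      = real CARD('n) * \<sigma>\<^sup>2 + (norm (c - a))\<^sup>2"
    unfolding power2_norm_eq_sum_Basis by (simp add: sum.distrib)
  finally show ?thesis .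
qed

text \<open>Completing the square shows that along the line the density is proportional to a normal
  density centred at \<open>(c - x) \<bullet> u\<close>. The value at \<open>r = 0\<close> fixes the
  factor; the quotient is multiplied out.\<close>

lemma gauss_density_line:
  fixes c x u :: "real^'n"
  assumes s: "\<sigma> > 0" and u: "norm u = 1"
  shows "gauss_density \<sigma> c (x + r *\<^sub>R u) * normal_density ((c - x) \<bullet> u) \<sigma> 0
       = gauss_density \<sigma> c x * normal_density ((c - x) \<bullet> u) \<sigma> r"
proof -
  have uu: "u \<bullet> u = 1" using u by (simp add: norm_eq_1)
  have "(norm (x + r *\<^sub>R u - c))\<^sup>2 = (norm (x - c))\<^sup>2 - 2 * r * ((c - x) \<bullet> u) + r\<^sup>2"
    unfolding power2_norm_eq_inner
    by (simp add: inner_add_left inner_add_right inner_diff_left inner_diff_right uu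
        inner_commute power2_eq_square algebra_simps)
  then have "(norm (x + r *\<^sub>R u - c))\<^sup>2 + (0 - (c - x) \<bullet> u)\<^sup>2
      = (norm (x - c))\<^sup>2 + (r - (c - x) \<bullet> u)\<^sup>2"
    by (simp add: power2_eq_square algebra_simps)
  then have "- (norm (x + r *\<^sub>R u - c))\<^sup>2 / (2 * \<sigma>\<^sup>2) + - (0 - (c - x) \<bullet> u)\<^sup>2 / (2 * \<sigma>\<^sup>2)
      = - (norm (x - c))\<^sup>2 / (2 * \<sigma>\<^sup>2) + - (r - (c - x) \<bullet> u)\<^sup>2 / (2 * \<sigma>\<^sup>2)"
    unfolding add_divide_distrib[symmetric] by simp
  then have "exp (- (norm (x + r *\<^sub>R u - c))\<^sup>2 / (2 * \<sigma>\<^sup>2)) * exp (- (0 - (c - x) \<bullet> u)\<^sup>2 / (2 * \<sigma>\<^sup>2))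
      = exp (- (norm (x - c))\<^sup>2 / (2 * \<sigma>\<^sup>2)) * exp (- (r - (c - x) \<bullet> u)\<^sup>2 / (2 * \<sigma>\<^sup>2))"
    unfolding exp_add[symmetric] by simp
  then show ?thesis unfolding gauss_density_def normal_density_def by simp
qed

text \<open>Conditionally on the component of a Gaussian vector orthogonal to \<open>u\<close>, its component
  along \<open>u\<close> is Gaussian, hence may be resampled. Translation invariance makes a choice of
  coordinates adapted to \<open>u\<close> unnecessary.\<close>

lemma gauss_resample:
  fixes c u :: "real^'n" and F :: "real^'n \<Rightarrow> ennreal"
  assumes s: "\<sigma> > 0" and u: "norm u = 1" and [measurable]: "F \<in> borel_measurable borel"
  shows "(\<integral>\<^sup>+ x. ennreal (gauss_density \<sigma> c x) * F x \<partial>lborel)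
    = (\<integral>\<^sup>+ x. ennreal (gauss_density \<sigma> c x)
        * (\<integral>\<^sup>+ r. ennreal (normal_density ((c - x) \<bullet> u) \<sigma> r) * F (x + r *\<^sub>R u) \<partial>lborel) \<partial>lborel)"
proof -
  define n where "n = (\<lambda>x. normal_density ((c - x) \<bullet> u) \<sigma> 0)"
  define G where "G = gauss_density \<sigma> c"
  have [measurable]: "n \<in> borel_measurable borel" "G \<in> borel_measurable borel"
    unfolding n_def G_def normal_density_def by measurable
  have uu: "u \<bullet> u = 1" using u by (simp add: norm_eq_1)
  have G0: "G x \<ge> 0" and n0: "n x \<ge> 0" for x
    by (auto simp: G_def n_def gauss_density_nonneg)
  have [measurable]: "(\<lambda>(x, r). ennreal (normal_density ((c - x) \<bullet> u) \<sigma> r) * F (x + r *\<^sub>R u))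
      \<in> borel_measurable (borel \<Otimes>\<^sub>M borel)"
    unfolding normal_density_def by measurable
  \<comment> \<open>Between the two uses of Fubini below, \<open>x\<close> is shifted by
    \<open>r *\<^sub>R u\<close>. This turns the remaining factor \<open>n\<close> into a normal
    density in \<open>r\<close>, which integrates to \<open>1\<close>.\<close>
  have mass: "(\<integral>\<^sup>+ r. ennreal (n (x - r *\<^sub>R u)) \<partial>lborel) = 1" for x
  proof -
    have "n (x - r *\<^sub>R u) = normal_density ((x - c) \<bullet> u) \<sigma> r" for r
    proof -
      have "(0 - (c - (x - r *\<^sub>R u)) \<bullet> u)\<^sup>2 = (r - (x - c) \<bullet> u)\<^sup>2"
        by (simp add: inner_diff_left uu power2_eq_square algebra_simps)
      then show ?thesis unfolding n_def normal_density_def by presburger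
    qed
    then show ?thesis by (simp add: nn_integral_normal_density[OF s])
  qed
  have "(\<integral>\<^sup>+ x. ennreal (G x)
        * (\<integral>\<^sup>+ r. ennreal (normal_density ((c - x) \<bullet> u) \<sigma> r) * F (x + r *\<^sub>R u) \<partial>lborel) \<partial>lborel)
    = (\<integral>\<^sup>+ x. (\<integral>\<^sup>+ r. ennreal (G x)
        * (ennreal (normal_density ((c - x) \<bullet> u) \<sigma> r) * F (x + r *\<^sub>R u)) \<partial>lborel) \<partial>lborel)"
    by (intro nn_integral_cong nn_integral_cmult[symmetric]) measurable
  also have "\<dots> = (\<integral>\<^sup>+ x. (\<integral>\<^sup>+ r. ennreal (G (x + r *\<^sub>R u)) * ennreal (n x) * F (x + r *\<^sub>R u) \<partial>lborel) \<partial>lborel)"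
  proof (intro nn_integral_cong)
    fix x r
    have "ennreal (G (x + r *\<^sub>R u)) * ennreal (n x)
        = ennreal (G x) * ennreal (normal_density ((c - x) \<bullet> u) \<sigma> r)"
      using gauss_density_line[OF s u, of c x r] G0 n0 unfolding G_def n_def
      by (simp add: ennreal_mult[symmetric])
    then show "ennreal (G x) * (ennreal (normal_density ((c - x) \<bullet> u) \<sigma> r) * F (x + r *\<^sub>R u))
       = ennreal (G (x + r *\<^sub>R u)) * ennreal (n x) * F (x + r *\<^sub>R u)"
      by (simp add: mult.assoc[symmetric])
  qed
  also have "\<dots> = (\<integral>\<^sup>+ r. (\<integral>\<^sup>+ x. ennreal (G (x + r *\<^sub>R u)) * ennreal (n x) * F (x + r *\<^sub>R u) \<partial>lborel) \<partial>lborel)"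
    by (rule lborel_pair.Fubini') measurable
  also have "\<dots> = (\<integral>\<^sup>+ r. (\<integral>\<^sup>+ x. ennreal (G x) * ennreal (n (x - r *\<^sub>R u)) * F x \<partial>lborel) \<partial>lborel)"
  proof (rule nn_integral_cong)
    fix r
    show "(\<integral>\<^sup>+ x. ennreal (G (x + r *\<^sub>R u)) * ennreal (n x) * F (x + r *\<^sub>R u) \<partial>lborel)
        = (\<integral>\<^sup>+ x. ennreal (G x) * ennreal (n (x - r *\<^sub>R u)) * F x \<partial>lborel)"
      using nn_integral_lborel_shift[of "\<lambda>x. ennreal (G x) * ennreal (n (x - r *\<^sub>R u)) * F x" "r *\<^sub>R u"]
      by simp
  qed
  also have "\<dots> = (\<integral>\<^sup>+ x. (\<integral>\<^sup>+ r. ennreal (G x) * ennreal (n (x - r *\<^sub>R u)) * F x \<partial>lborel) \<partial>lborel)"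
    by (rule lborel_pair.Fubini') measurable
  also have "\<dots> = (\<integral>\<^sup>+ x. ennreal (G x) * F x \<partial>lborel)"
    by (intro nn_integral_cong) (simp add: nn_integral_cmult nn_integral_multc mass)
  finally show ?thesis by (simp add: G_def)
qed

section \<open>Restriction of a form to lines\<close>

definition form_eval :: "(('n::finite \<Rightarrow> nat) \<Rightarrow> real) \<Rightarrow> nat \<Rightarrow> real^'n \<Rightarrow> real" where
  "form_eval c d x = (\<Sum>\<alpha>\<in>{\<alpha>. sum \<alpha> UNIV = d}. c \<alpha> * (\<Prod>i\<in>UNIV. (x $ i) ^ \<alpha> i))"

text \<open>The parameter is complex because the radius of convergence of the reciprocal is governed
  by non-real roots too.\<close>

definition line_eval ::
    "(('n::finite \<Rightarrow> nat) \<Rightarrow> real) \<Rightarrow> nat \<Rightarrow> real^'n \<Rightarrow> real^'n \<Rightarrow> complex \<Rightarrow> complex" where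
  "line_eval c d x v t = (\<Sum>\<alpha>\<in>{\<alpha>. sum \<alpha> UNIV = d}. complex_of_real (c \<alpha>)
     * (\<Prod>i\<in>UNIV. (complex_of_real (x $ i) + t * complex_of_real (v $ i)) ^ \<alpha> i))"

text \<open>This is the function \<open>\<psi>\<close> of the overview. In \<open>ennreal\<close> it
  is infinite if the form vanishes at \<open>x\<close> (the root \<open>t = 0\<close>), and
  \<open>0\<close> if there is no root at all.\<close>

definition root_proximity ::
    "(('n::finite \<Rightarrow> nat) \<Rightarrow> real) \<Rightarrow> nat \<Rightarrow> real^'n \<Rightarrow> real^'n \<Rightarrow> ennreal" where
  "root_proximity c d x v
     = (SUP t\<in>{t. line_eval c d x v t = 0}. inverse (ennreal (sqrt (cmod t))))"

lemma line_eval_of_real: "line_eval c d x v (of_real r) = of_real (form_eval c d (x + r *\<^sub>R v))"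
  by (simp add: line_eval_def form_eval_def)

lemma line_eval_0: "line_eval c d x v 0 = of_real (form_eval c d x)"
  by (simp add: line_eval_def form_eval_def)

lemma line_eval_affine:
  "line_eval c d (x + r *\<^sub>R u) (b *\<^sub>R u) t = line_eval c d x u (of_real r + t * of_real b)"
  by (simp add: line_eval_def algebra_simps)

lemma continuous_on_form_eval: "continuous_on UNIV (form_eval c d)"
  unfolding form_eval_def by (intro continuous_intros)

text \<open>With outer variable \<open>t\<close> and inner variable \<open>l\<close>, the second
  condition describes polynomials in \<open>t\<close> and \<open>t l\<close>. These arise from
  substituting \<open>x + t (u + l w)\<close> into a form.\<close>

definition graded :: "nat \<Rightarrow> complex poly poly \<Rightarrow> bool" where
  "graded m P \<longleftrightarrow> degree P \<le> m \<and> (\<forall>j. degree (coeff P j) \<le> j)"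

lemma graded_mult:
  assumes P: "graded m P" and Q: "graded k Q"
  shows "graded (m + k) (P * Q)"
  unfolding graded_def
proof (intro conjI allI)
  show "degree (P * Q) \<le> m + k"
    using degree_mult_le[of P Q] P Q by (simp add: graded_def)
  fix j
  show "degree (coeff (P * Q) j) \<le> j"
    unfolding coeff_mult
  proof (rule degree_sum_le)
    fix i assume i: "i \<in> {..j}"
    have "degree (coeff P i * coeff Q (j - i)) \<le> degree (coeff P i) + degree (coeff Q (j - i))"
      by (rule degree_mult_le)
    also have "\<dots> \<le> i + (j - i)" using P Q unfolding graded_def by (intro add_mono) auto
    finally show "degree (coeff P i * coeff Q (j - i)) \<le> j" using i by simp
  qed simp
qed

lemma graded_const: "graded 0 [:[:a:]:]"
  by (simp add: graded_def coeff_pCons split: nat.split)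

lemma graded_linear: "graded 1 [:[:a:], [:b, e:]:]"
  by (auto simp: graded_def coeff_pCons split: nat.split)

lemma graded_power: "graded m P \<Longrightarrow> graded (k * m) (P ^ k)"
  using graded_const[of 1] by (induction k) (auto intro!: graded_mult simp: one_pCons[symmetric])

lemma graded_prod:
  "(\<And>i. i \<in> I \<Longrightarrow> graded (m i) (P i)) \<Longrightarrow> graded (sum m I) (\<Prod>i\<in>I. P i)"
  using graded_const[of 1]
  by (induction I rule: infinite_finite_induct) (auto intro!: graded_mult simp: one_pCons[symmetric])

lemma graded_sum:
  assumes "\<And>i. i \<in> I \<Longrightarrow> graded m (P i)"
  shows "graded m (\<Sum>i\<in>I. P i)"
  using assms unfolding graded_def
  by (cases "finite I") (auto simp: coeff_sum intro!: degree_sum_le)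

lemma poly_map_poly_eval:
  "poly (map_poly (\<lambda>q. poly q l) P) t = poly (poly P [:t:]) (l :: complex)"
  by (induction P) (simp_all add: map_poly_pCons)

lemma graded_line_poly:
  fixes c :: "('n::finite \<Rightarrow> nat) \<Rightarrow> real" and x u w :: "real^'n"
  obtains P where "graded d P"
    "\<And>l t. poly (map_poly (\<lambda>q. poly q (complex_of_real l)) P) t = line_eval c d x (u + l *\<^sub>R w) t"
proof
  \<comment> \<open>\<open>L i\<close> is coordinate \<open>i\<close> of
    \<open>x + t (u + l w)\<close>.\<close>
  define L where "L = (\<lambda>i. [:[:complex_of_real (x $ i):],
    [:complex_of_real (u $ i), complex_of_real (w $ i):]:])"
  define P where "P = (\<Sum>\<alpha>\<in>{\<alpha>. sum \<alpha> UNIV = d}. [:[:complex_of_real (c \<alpha>):]:] * (\<Prod>i\<in>UNIV. L i ^ \<alpha> i))"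
  show "graded d P"
    unfolding P_def
  proof (rule graded_sum)
    fix \<alpha> :: "'n \<Rightarrow> nat" assume \<alpha>: "\<alpha> \<in> {\<alpha>. sum \<alpha> UNIV = d}"
    have "graded (0 + (\<Sum>i\<in>UNIV. \<alpha> i * 1)) ([:[:complex_of_real (c \<alpha>):]:] * (\<Prod>i\<in>UNIV. L i ^ \<alpha> i))"
      unfolding L_def by (intro graded_mult graded_const graded_prod graded_power graded_linear)
    then show "graded d ([:[:complex_of_real (c \<alpha>):]:] * (\<Prod>i\<in>UNIV. L i ^ \<alpha> i))"
      using \<alpha> by simp
  qed
  fix l t
  show "poly (map_poly (\<lambda>q. poly q (complex_of_real l)) P) t = line_eval c d x (u + l *\<^sub>R w) t"
    unfolding poly_map_poly_eval
    by (simp add: P_def L_def line_eval_def poly_sum poly_prod algebra_simps)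
qed

lemma line_poly:
  fixes c :: "('n::finite \<Rightarrow> nat) \<Rightarrow> real" and x u :: "real^'n"
  obtains Q where "degree Q \<le> d" "\<And>t. poly Q t = line_eval c d x u t"
proof -
  obtain P where P: "graded d P"
    "\<And>l t. poly (map_poly (\<lambda>q. poly q (complex_of_real l)) P) t = line_eval c d x (u + l *\<^sub>R 0) t"
    using graded_line_poly[where x=x and u=u and w=0 and c=c and d=d] by blast
  have "degree (map_poly (\<lambda>q. poly q (complex_of_real 0)) P) \<le> d"
    using P(1) map_poly_degree_leq[of "\<lambda>q. poly q (complex_of_real 0)" P] by (simp add: graded_def)
  then show thesis using P(2)[of 0] by (intro that) auto
qed

text \<open>A superlevel set consists of the pairs whose line has a root in some open set
  \<open>U\<close>. Writing \<open>U\<close> as a countable union of compact boxes \<open>K\<close>,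
  the pairs with a root in \<open>K\<close> form the projection of a closed set along a compact
  factor, hence a closed set.\<close>

lemma borel_measurable_root_proximity [measurable]:
  fixes c :: "('n::finite \<Rightarrow> nat) \<Rightarrow> real"
  shows "(\<lambda>(x, v). root_proximity c d x v) \<in> borel_measurable (borel \<Otimes>\<^sub>M borel)"
proof -
  let ?f = "\<lambda>t::complex. inverse (ennreal (sqrt (cmod t)))"
  have cont_f: "continuous_on UNIV ?f" by (intro continuous_intros continuous_on_ennreal)
  have roots: "{z \<in> space borel. \<exists>t\<in>U. line_eval c d (fst z) (snd z) t = 0} \<in> sets borel"
    if U: "open U" for U :: "complex set"
  proof -
    define Z where "Z = {p. line_eval c d (fst (snd p)) (snd (snd p)) (fst p) = 0}"
    have "continuous_on UNIV (\<lambda>p. line_eval c d (fst (snd p)) (snd (snd p)) (fst p))"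
      unfolding line_eval_def by (intro continuous_intros)
    then have "closed Z" unfolding Z_def by (intro closed_Collect_eq) auto
    obtain D where D: "countable D" "\<And>X. X \<in> D \<Longrightarrow> compact X" "U = \<Union>D"
      using open_countable_Union_open_cbox[OF U] compact_cbox by metis
    have "closed (snd ` (K \<times> UNIV \<inter> Z))" if "compact K" for K
      using Starlike.closed_map_snd[OF that closedin_closed_Int[OF \<open>closed Z\<close>], of UNIV]
      by simp
    then have "(\<Union>K\<in>D. snd ` (K \<times> UNIV \<inter> Z)) \<in> sets borel"
      using D by (intro sets.countable_UN'') auto
    moreover have "snd ` (K \<times> UNIV \<inter> Z) = {z. \<exists>t\<in>K. line_eval c d (fst z) (snd z) t = 0}" for K
    proof (intro set_eqI iffI)
      fix z assume "z \<in> {z. \<exists>t\<in>K. line_eval c d (fst z) (snd z) t = 0}"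
      then obtain t where "(t, z) \<in> K \<times> UNIV \<inter> Z" by (auto simp: Z_def)
      then show "z \<in> snd ` (K \<times> UNIV \<inter> Z)" by (metis imageI snd_conv)
    qed (auto simp: Z_def)
    moreover have "(\<Union>K\<in>D. {z. \<exists>t\<in>K. line_eval c d (fst z) (snd z) t = 0})
        = {z \<in> space borel. \<exists>t\<in>U. line_eval c d (fst z) (snd z) t = 0}"
      unfolding D(3) by auto
    ultimately show ?thesis by simp
  qed
  have "(\<lambda>z. root_proximity c d (fst z) (snd z)) \<in> borel_measurable borel"
  proof (rule borel_measurableI_greater)
    fix a :: ennreal
    have "open {t. a < ?f t}"
      by (intro open_Collect_less continuous_on_const cont_f)
    from roots[OF this]
    have "{z \<in> space borel. \<exists>t\<in>{t. a < ?f t}. line_eval c d (fst z) (snd z) t = 0} \<in> sets borel" .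
    also have "{z \<in> space borel. \<exists>t\<in>{t. a < ?f t}. line_eval c d (fst z) (snd z) t = 0}
        = {z \<in> space borel. a < root_proximity c d (fst z) (snd z)}"
      by (auto simp: root_proximity_def less_SUP_iff)
    finally show "{z \<in> space borel. a < root_proximity c d (fst z) (snd z)} \<in> sets borel" .
  qed
  then show ?thesis by (simp add: borel_prod case_prod_beta')
qed

section \<open>Geometric means of distances to a Gaussian point\<close>

text \<open>Let \<open>X\<close> be the geometric mean of the square roots of the distances. By the
  arithmetic-geometric mean inequality \<open>1 / X\<close> is at most the average of the inverse
  square roots, whose expectation is at most \<open>B\<close>. Integrating
  \<open>2 \<le> B X + 1 / (B X)\<close> then gives \<open>2 \<le> B E(X) + 1\<close>.\<close>

lemma one_le_normal_geometric_mean: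
  fixes bs :: "complex list"
  assumes k: "length bs = k" "k > 0"
  shows "1 \<le> ennreal (2 * sqrt (2 / sqrt (2 * pi)))
     * (\<integral>\<^sup>+ g. ennreal (normal_density \<mu> 1 g)
         * ennreal (\<Prod>b\<leftarrow>bs. cmod (complex_of_real g - b) powr (1 / (2 * real k))) \<partial>lborel)"
proof -
  \<comment> \<open>The bound of \<open>normal_inverse_sqrt_dist_finite_set\<close> for a single
    point and unit variance.\<close>
  define B where "B = 2 * sqrt (2 / sqrt (2 * pi))"
  have B: "B > 0" by (simp add: B_def)
  define X where "X = (\<lambda>g. \<Prod>j<k. cmod (complex_of_real g - bs ! j) powr (1 / (2 * real k)))"
  define I where "I = (\<lambda>j g. inverse (ennreal (sqrt (cmod (complex_of_real g - bs ! j)))))"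
  have [measurable]: "X \<in> borel_measurable borel" "I j \<in> borel_measurable borel" for j
    unfolding X_def I_def by measurable
  have X0: "X g \<ge> 0" for g unfolding X_def by (intro prod_nonneg) auto
  have pw: "2 \<le> ennreal B * ennreal (X g) + ennreal (1 / (B * k)) * (\<Sum>j<k. I j g)" for g
  proof (cases "\<exists>j<k. complex_of_real g = bs ! j")
    \<comment> \<open>If \<open>g\<close> hits one of the points, \<open>X\<close> vanishes but the
      sum of inverse square roots is infinite.\<close>
    case True
    then obtain j where j: "j < k" "I j g = \<infinity>" by (auto simp: I_def)
    have "I j g \<le> (\<Sum>j<k. I j g)"
      using j by (intro member_le_sum) auto
    then have top: "(\<Sum>j<k. I j g) = top"
      using j by (metis infinity_ennreal_def top_unique)
    show ?thesis unfolding top using B k by (simp add: ennreal_mult_top)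
  next
    case False
    then have pos: "cmod (complex_of_real g - bs ! j) > 0" if "j < k" for j
      using that by auto
    have Xpos: "X g > 0" unfolding X_def using pos by (intro prod_pos) fastforce
    have "1 / X g = (\<Prod>j<k. 1 / sqrt (cmod (complex_of_real g - bs ! j))) powr (1 / real k)"
    proof -
      have "1 / X g = (\<Prod>j<k. (1 / sqrt (cmod (complex_of_real g - bs ! j))) powr (1 / real k))"
        unfolding X_def
      proof (subst prod_dividef[of "\<lambda>_. 1", simplified, symmetric], rule prod.cong)
        fix j assume "j \<in> {..<k}"
        then have "cmod (complex_of_real g - bs ! j) > 0" using pos by simp
        then show "1 / cmod (complex_of_real g - bs ! j) powr (1 / (2 * real k))
          = (1 / sqrt (cmod (complex_of_real g - bs ! j))) powr (1 / real k)"
          by (simp add: powr_half_sqrt[symmetric] powr_divide powr_powr)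
      qed simp
      also have "\<dots> = (\<Prod>j<k. 1 / sqrt (cmod (complex_of_real g - bs ! j))) powr (1 / real k)"
        by (rule prod_powr_distrib[symmetric])
      finally show ?thesis .
    qed
    also have "\<dots> \<le> (\<Sum>j<k. 1 / sqrt (cmod (complex_of_real g - bs ! j)) / real k)"
      using arith_geom_mean[of "{..<k}" "\<lambda>j. 1 / sqrt (cmod (complex_of_real g - bs ! j))"] k
      by (auto simp: root_powr_inverse)
    finally have amgm: "1 / X g \<le> (\<Sum>j<k. 1 / sqrt (cmod (complex_of_real g - bs ! j))) / real k"
      by (simp add: sum_divide_distrib)
    have "2 \<le> B * X g + 1 / (B * X g)"
    proof -
      have "(B * X g - 1)\<^sup>2 \<ge> 0" by simp
      then show ?thesis using B Xpos by (simp add: field_simps power2_eq_square)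
    qed
    also have "1 / (B * X g) = 1 / B * (1 / X g)" by simp
    also have "\<dots> \<le> 1 / B * ((\<Sum>j<k. 1 / sqrt (cmod (complex_of_real g - bs ! j))) / real k)"
      using B by (intro mult_left_mono amgm) auto
    finally have "ennreal 2 \<le> ennreal (B * X g
        + 1 / (B * k) * (\<Sum>j<k. 1 / sqrt (cmod (complex_of_real g - bs ! j))))"
      by (intro ennreal_leI) simp
    also have "\<dots> = ennreal B * ennreal (X g)
        + ennreal (1 / (B * k)) * (\<Sum>j<k. ennreal (1 / sqrt (cmod (complex_of_real g - bs ! j))))"
      using B Xpos k
      by (simp add: ennreal_plus[symmetric] ennreal_mult[symmetric] sum_nonneg sum_ennreal
          del: ennreal_plus)
    also have "(\<Sum>j<k. ennreal (1 / sqrt (cmod (complex_of_real g - bs ! j)))) = (\<Sum>j<k. I j g)"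
      using pos by (intro sum.cong) (auto simp: I_def inverse_ennreal divide_inverse)
    finally show ?thesis by simp
  qed
  have int_I: "(\<integral>\<^sup>+ g. ennreal (normal_density \<mu> 1 g) * I j g \<partial>lborel) \<le> ennreal B" for j
    using normal_inverse_sqrt_dist_finite_set[of 1 "{bs ! j}" 1 \<mu>] by (simp add: I_def B_def)
  have "2 = (\<integral>\<^sup>+ g. ennreal (normal_density \<mu> 1 g) * 2 \<partial>lborel)"
    by (simp add: nn_integral_multc nn_integral_normal_density)
  also have "\<dots> \<le> (\<integral>\<^sup>+ g. ennreal (normal_density \<mu> 1 g)
      * (ennreal B * ennreal (X g) + ennreal (1 / (B * k)) * (\<Sum>j<k. I j g)) \<partial>lborel)"
    by (intro nn_integral_mono mult_left_mono pw) auto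
  also have "\<dots> = (\<integral>\<^sup>+ g. ennreal B * (ennreal (normal_density \<mu> 1 g) * ennreal (X g))
      + ennreal (1 / (B * k)) * (\<Sum>j<k. ennreal (normal_density \<mu> 1 g) * I j g) \<partial>lborel)"
    by (intro nn_integral_cong) (simp add: distrib_left sum_distrib_left mult_ac)
  also have "\<dots> = ennreal B * (\<integral>\<^sup>+ g. ennreal (normal_density \<mu> 1 g) * ennreal (X g) \<partial>lborel)
      + ennreal (1 / (B * k)) * (\<Sum>j<k. (\<integral>\<^sup>+ g. ennreal (normal_density \<mu> 1 g) * I j g \<partial>lborel))"
    by (simp add: nn_integral_add nn_integral_cmult nn_integral_sum)
  also have "\<dots> \<le> ennreal B * (\<integral>\<^sup>+ g. ennreal (normal_density \<mu> 1 g) * ennreal (X g) \<partial>lborel)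
      + ennreal (1 / (B * k)) * (\<Sum>j<k. ennreal B)"
    by (intro add_left_mono mult_left_mono sum_mono int_I) auto
  also have "ennreal (1 / (B * k)) * (\<Sum>j<k. ennreal B) = 1"
    using B k by (simp add: sum_ennreal ennreal_mult'[symmetric] ennreal_of_nat_eq_real_of_nat)
  finally have "1 + 1 \<le> 1 + ennreal B
      * (\<integral>\<^sup>+ g. ennreal (normal_density \<mu> 1 g) * ennreal (X g) \<partial>lborel)"
    by (simp add: add.commute)
  then have "1 \<le> ennreal B
      * (\<integral>\<^sup>+ g. ennreal (normal_density \<mu> 1 g) * ennreal (X g) \<partial>lborel)"
    by (subst (asm) ennreal_add_left_cancel_le) auto
  moreover have "(\<Prod>b\<leftarrow>bs. cmod (complex_of_real g - b) powr (1 / (2 * real k))) = X g" for g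
    unfolding X_def prod.list_conv_set_nth using k by (simp add: atLeast0LessThan)
  ultimately show ?thesis unfolding B_def by simp
qed

section \<open>Zeros of a form seen from random directions\<close>

lemma prod_list_powr:
  fixes f :: "'a \<Rightarrow> real"
  assumes "\<And>b. f b \<ge> 0"
  shows "(\<Prod>b\<leftarrow>bs. f b) powr r = (\<Prod>b\<leftarrow>bs. f b powr r)"
proof (induction bs)
  case (Cons b bs)
  have "(\<Prod>b\<leftarrow>bs. f b) \<ge> 0" using assms by (induction bs) auto
  with Cons show ?case using assms by (simp add: powr_mult)
qed simp

text \<open>Homogenisation: the left product is a value in direction \<open>u + (1 / g) v\<close>,
  and scaling by \<open>g\<close> moves it to direction \<open>v + g u\<close>.\<close>

lemma cmod_prod_list_rescale:
  fixes g :: real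
  assumes "g \<noteq> 0"
  shows "\<bar>g\<bar> ^ length bs * cmod (poly (\<Prod>b\<leftarrow>bs. [:1, - b:]) (1 / of_real g))
    = (\<Prod>b\<leftarrow>bs. cmod (of_real g - b))"
proof (induction bs)
  case (Cons b bs)
  have "\<bar>g\<bar> * cmod (1 - b / of_real g) = cmod (of_real g * (1 - b / of_real g))"
    by (simp add: norm_mult)
  also have "of_real g * (1 - b / of_real g) = of_real g - b"
    using assms by (simp add: algebra_simps)
  finally have "\<bar>g\<bar> * cmod (1 - b / of_real g) = cmod (of_real g - b)" .
  moreover have "\<bar>g\<bar> ^ length (b # bs) * cmod (poly (\<Prod>b\<leftarrow>b # bs. [:1, - b:]) (1 / of_real g))
    = (\<bar>g\<bar> * cmod (1 - b / of_real g))
      * (\<bar>g\<bar> ^ length bs * cmod (poly (\<Prod>b\<leftarrow>bs. [:1, - b:]) (1 / of_real g)))"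
  proof -
    have "poly [:1, - b:] (1 / of_real g) = 1 - b / of_real g" by simp
    then show ?thesis
      by (simp only: list.map prod_list.Cons poly_mult norm_mult length_Cons power_Suc mult_ac)
  qed
  ultimately show ?case unfolding Cons.IH by simp
qed simp

text \<open>The \<open>k\<close>-th Taylor coefficient at \<open>x\<close> of the reciprocal of the form is a homogeneous polynomial of
  degree \<open>k\<close> in the direction. On the line \<open>v + g u\<close> it is a polynomial in \<open>g\<close> whose leading
  coefficient is its value \<open>a\<close> at \<open>u\<close>, so it equals \<open>a\<close> times a product of at most \<open>k\<close> linear
  factors; the list is padded by zeros to have length \<open>k\<close>.\<close>

lemma root_proximity_ge:
  fixes c :: "('n::finite \<Rightarrow> nat) \<Rightarrow> real" and x u v :: "real^'n"
  assumes px: "form_eval c d x \<noteq> 0" and k: "k > 0"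
    and Q: "\<And>t. poly Q t = line_eval c d x u t"
    and a: "a = fps_nth (inverse (fps_of_poly Q)) k" "a \<noteq> 0"
  obtains bs where "length bs = k"
    "\<And>g. g \<noteq> 0 \<Longrightarrow> ennreal ((\<bar>form_eval c d x\<bar> * cmod a / real (Suc k) ^ d) powr (1 / (2 * real k)))
        * ennreal (\<Prod>b\<leftarrow>bs. cmod (complex_of_real g - b) powr (1 / (2 * real k)))
      \<le> root_proximity c d x (v + g *\<^sub>R u)"
proof -
  \<comment> \<open>The direction is written as \<open>u + l v\<close>, so \<open>v + g u\<close>
    corresponds to \<open>l = 1 / g\<close> up to the factor \<open>g\<close>, and the coefficient
    \<open>a\<close> at \<open>u\<close> is the constant term of \<open>h\<close>.\<close>
  obtain P where P: "graded d P"
    "\<And>l t. poly (map_poly (\<lambda>q. poly q (complex_of_real l)) P) t = line_eval c d x (u + l *\<^sub>R v) t"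
    using graded_line_poly[where x=x and u=u and w=v and c=c and d=d] by blast
  define Ql where "Ql = (\<lambda>l. map_poly (\<lambda>q. poly q (complex_of_real l)) P)"
  have Ql0: "poly (Ql l) 0 = of_real (form_eval c d x)" for l
    unfolding Ql_def P(2) line_eval_0 ..
  have degQl: "degree (Ql l) \<le> d" for l
    unfolding Ql_def using P(1) map_poly_degree_leq[of "\<lambda>q. poly q (complex_of_real l)" P]
    by (simp add: graded_def)
  have "poly (coeff P 0) 0 = of_real (form_eval c d x)"
    using Ql0[of 0] by (simp add: Ql_def poly_0_coeff_0 coeff_map_poly)
  then have "coeff (coeff P 0) 0 \<noteq> 0" using px by (simp add: poly_0_coeff_0)
  then obtain h where h: "degree h \<le> k"
    "\<And>l. poly h l = fps_nth (inverse (fps_of_poly (map_poly (\<lambda>q. poly q l) P))) k"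
    using inverse_fps_coeff_polynomial[of P k] P(1) by (auto simp: graded_def)
  have "Ql 0 = Q"
    unfolding poly_eq_poly_eq_iff[symmetric] using P(2)[of 0] by (auto simp: Ql_def Q)
  then have h0: "poly h 0 = a" using h(2)[of 0] by (simp add: a Ql_def)
  obtain bs0 where bs0: "length bs0 = degree h" "h = smult a (\<Prod>b\<leftarrow>bs0. [:1, - b:])"
    using poly_factor_unit_constant[of h] a(2) unfolding h0 by blast
  define bs where "bs = bs0 @ replicate (k - degree h) 0"
  have len: "length bs = k" using bs0(1) h(1) by (simp add: bs_def)
  have prod_bs: "(\<Prod>b\<leftarrow>bs. [:1, - b:]) = (\<Prod>b\<leftarrow>bs0. [:1, - b:])"
    by (simp add: bs_def one_pCons[symmetric])
  show thesis
  proof (rule that[OF len])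
    fix g :: real assume g: "g \<noteq> 0"
    show "ennreal ((\<bar>form_eval c d x\<bar> * cmod a / real (Suc k) ^ d) powr (1 / (2 * real k)))
        * ennreal (\<Prod>b\<leftarrow>bs. cmod (complex_of_real g - b) powr (1 / (2 * real k)))
      \<le> root_proximity c d x (v + g *\<^sub>R u)"
    proof (cases "root_proximity c d x (v + g *\<^sub>R u)")
      case (real y)
      \<comment> \<open>Multiplying the direction by \<open>g\<close> divides the roots by
        \<open>g\<close>, so \<open>t / g\<close> is a root counted in
        \<open>root_proximity\<close>, whence
        \<open>1 \<le> y * sqrt (cmod (t / g))\<close>.\<close>
      have roots: "1 \<le> y\<^sup>2 / \<bar>g\<bar> * cmod t" if t: "poly (Ql (1 / g)) t = 0" for t
      proof -
        have t0: "t \<noteq> 0" using t Ql0[of "1/g"] px by auto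
        have "line_eval c d x (v + g *\<^sub>R u) (t / of_real g) = line_eval c d x (u + (1 / g) *\<^sub>R v) t"
          using line_eval_affine[of c d x 0 "u + (1 / g) *\<^sub>R v" g "t / of_real g"] g
          by (simp add: scaleR_add_right add.commute)
        also have "\<dots> = 0" using t P(2)[of "1 / g" t] by (simp add: Ql_def)
        finally have "inverse (ennreal (sqrt (cmod (t / of_real g))))
            \<le> root_proximity c d x (v + g *\<^sub>R u)"
          unfolding root_proximity_def by (intro SUP_upper) simp
        then have "ennreal (inverse (sqrt (cmod (t / of_real g)))) \<le> ennreal y"
          unfolding real using t0 g by (subst (asm) inverse_ennreal) auto
        then have "inverse (sqrt (cmod (t / of_real g))) \<le> y"
          using real by (simp add: ennreal_le_iff)
        then have "1 \<le> y * sqrt (cmod (t / of_real g))"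
          using t0 g by (simp add: field_simps)
        then have "1\<^sup>2 \<le> (y * sqrt (cmod (t / of_real g)))\<^sup>2"
          by (intro power_mono) auto
        then show ?thesis using g by (simp add: power_mult_distrib norm_divide)
      qed
      have "cmod (poly (Ql (1/g)) 0) * cmod (fps_nth (inverse (fps_of_poly (Ql (1/g)))) k)
          \<le> real (Suc k) ^ d * (y\<^sup>2 / \<bar>g\<bar>) ^ k"
        using px roots degQl by (intro inverse_fps_poly_bound) (auto simp: Ql0)
      then have "\<bar>form_eval c d x\<bar> * cmod (poly h (1 / of_real g)) \<le> real (Suc k) ^ d * (y\<^sup>2 / \<bar>g\<bar>) ^ k"
        unfolding Ql0 using h(2)[of "1 / of_real g"] by (simp add: Ql_def)
      then have "\<bar>form_eval c d x\<bar> * (\<bar>g\<bar> ^ k * cmod (poly h (1 / of_real g))) \<le> real (Suc k) ^ d * (y\<^sup>2) ^ k"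
        using g by (simp add: power_divide field_simps)
      also have "\<bar>g\<bar> ^ k * cmod (poly h (1 / of_real g)) = cmod a * (\<Prod>b\<leftarrow>bs. cmod (of_real g - b))"
        using cmod_prod_list_rescale[OF g, of bs] unfolding len prod_bs
        by (subst bs0(2)) (simp add: norm_mult mult_ac)
      finally have le: "\<bar>form_eval c d x\<bar> * cmod a / real (Suc k) ^ d * (\<Prod>b\<leftarrow>bs. cmod (of_real g - b))
          \<le> y ^ (2 * k)"
        by (simp add: field_simps power_mult[symmetric] del: of_nat_Suc)
      have P0: "(\<Prod>b\<leftarrow>bs. cmod (of_real g - b)) \<ge> 0" by (induction bs) auto
      have "(\<bar>form_eval c d x\<bar> * cmod a / real (Suc k) ^ d * (\<Prod>b\<leftarrow>bs. cmod (of_real g - b)))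
            powr (1 / (2 * real k)) \<le> (y ^ (2 * k)) powr (1 / (2 * real k))"
        by (rule powr_mono2) (use le P0 in auto)
      also have "(y ^ (2 * k)) powr (1 / (2 * real k)) = y"
        using root_powr_inverse[of "2 * k" "y ^ (2 * k)"] k real
        by (simp add: real_root_power_cancel)
      finally have "(\<bar>form_eval c d x\<bar> * cmod a / real (Suc k) ^ d) powr (1 / (2 * real k))
          * (\<Prod>b\<leftarrow>bs. cmod (of_real g - b) powr (1 / (2 * real k))) \<le> y"
        using P0 by (subst (asm) powr_mult) (auto simp: prod_list_powr)
      then show ?thesis unfolding real
        by (subst ennreal_mult'[symmetric]) (auto intro!: ennreal_leI)
    qed simp
  qed
qed

text \<open>For each \<open>k\<close>, averaging \<open>root_proximity_ge\<close> over
  \<open>g\<close> removes the product over \<open>bs\<close> at the cost of the factor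
  \<open>B\<close>, uniformly in \<open>k\<close>. So the coefficients of the reciprocal along
  \<open>u\<close> grow at most like \<open>(B * j) ^ (2 * k)\<close>, up to polynomial factors, and
  the zero at distance \<open>e\<close> forces \<open>1 \<le> (B * j)\<^sup>2 * e\<close>.\<close>

lemma inverse_sqrt_dist_le_line:
  fixes c :: "('n::finite \<Rightarrow> nat) \<Rightarrow> real" and x u v :: "real^'n"
  assumes px: "form_eval c d x \<noteq> 0" and zero: "form_eval c d (x + e *\<^sub>R u) = 0" and e: "e > 0"
  shows "ennreal (1 / sqrt e) \<le> ennreal (2 * sqrt (2 / sqrt (2 * pi)))
    * (\<integral>\<^sup>+ g. ennreal (normal_density \<mu> 1 g) * root_proximity c d x (v + g *\<^sub>R u) \<partial>lborel)"
proof -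
  define B where "B = 2 * sqrt (2 / sqrt (2 * pi))"
  have B: "B > 0" by (simp add: B_def)
  define J where "J = (\<integral>\<^sup>+ g. ennreal (normal_density \<mu> 1 g) * root_proximity c d x (v + g *\<^sub>R u) \<partial>lborel)"
  have "ennreal (1 / sqrt e) \<le> ennreal B * J"
  proof (cases J)
    case (real j)
    obtain Q where Q: "degree Q \<le> d" "\<And>t. poly Q t = line_eval c d x u t"
      using line_poly[where x=x and u=u and c=c and d=d] by blast
    have Q0: "poly Q 0 \<noteq> 0" using px by (simp add: Q line_eval_0)
    have bound: "cmod (fps_nth (inverse (fps_of_poly Q)) k)
        \<le> 1 / \<bar>form_eval c d x\<bar> * real (Suc k) ^ d * ((B * j)\<^sup>2) ^ k" for k
    proof (cases "k = 0 \<or> fps_nth (inverse (fps_of_poly Q)) k = 0")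
      case True
      then show ?thesis
        by (auto simp: Q line_eval_0 poly_0_coeff_0[symmetric] norm_inverse divide_inverse)
    next
      case False
      then have k: "k > 0" by simp
      define a where "a = fps_nth (inverse (fps_of_poly Q)) k"
      have a0: "a \<noteq> 0" using False by (simp add: a_def)
      define W where "W = (\<bar>form_eval c d x\<bar> * cmod a / real (Suc k) ^ d) powr (1 / (2 * real k))"
      have W: "W \<ge> 0" by (simp add: W_def)
      obtain bs where bs: "length bs = k"
        "\<And>g. g \<noteq> 0 \<Longrightarrow> ennreal W
            * ennreal (\<Prod>b\<leftarrow>bs. cmod (complex_of_real g - b) powr (1 / (2 * real k)))
          \<le> root_proximity c d x (v + g *\<^sub>R u)"
        using root_proximity_ge[OF px k Q(2) a_def a0, of v] unfolding W_def by blast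
      define X where "X = (\<lambda>g. \<Prod>b\<leftarrow>bs. cmod (complex_of_real g - b) powr (1 / (2 * real k)))"
      have [measurable]: "X \<in> borel_measurable borel"
        unfolding X_def by (induction bs) auto
      have "ennreal W * 1 \<le> ennreal W * (ennreal B * (\<integral>\<^sup>+ g. ennreal (normal_density \<mu> 1 g) * ennreal (X g) \<partial>lborel))"
        using one_le_normal_geometric_mean[OF bs(1) k, of \<mu>] unfolding B_def X_def
        by (intro mult_left_mono) auto
      also have "\<dots> = ennreal B * (\<integral>\<^sup>+ g. ennreal (normal_density \<mu> 1 g) * (ennreal W * ennreal (X g)) \<partial>lborel)"
        by (simp add: nn_integral_cmult[symmetric] mult_ac)
      also have "\<dots> \<le> ennreal B * J"
        unfolding J_def
      proof (intro mult_left_mono nn_integral_mono_AE)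
        have "AE g in lborel. g \<notin> {0::real}"
          by (intro AE_not_in finite_imp_null_set_lborel) simp
        then show "AE g in lborel. ennreal (normal_density \<mu> 1 g) * (ennreal W * ennreal (X g))
            \<le> ennreal (normal_density \<mu> 1 g) * root_proximity c d x (v + g *\<^sub>R u)"
          by eventually_elim (auto simp: X_def intro!: mult_left_mono bs(2))
      qed simp
      also have "\<dots> = ennreal (B * j)" using real B by (simp add: ennreal_mult)
      finally have "W \<le> B * j" using B real by (simp add: ennreal_le_iff)
      then have "W ^ (2 * k) \<le> (B * j) ^ (2 * k)" using W by (intro power_mono) auto
      also have "W ^ (2 * k) = \<bar>form_eval c d x\<bar> * cmod a / real (Suc k) ^ d"
        unfolding W_def using k a0 px by (simp add: powr_realpow[symmetric] powr_powr)
      finally have "\<bar>form_eval c d x\<bar> * cmod a \<le> real (Suc k) ^ d * ((B * j)\<^sup>2) ^ k"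
        by (simp add: field_simps power_mult[symmetric] del: of_nat_Suc)
      then show ?thesis using px unfolding a_def[symmetric] by (simp add: field_simps del: of_nat_Suc)
    qed
    have "poly Q (of_real e) = 0" using zero by (simp add: Q line_eval_of_real)
    from inverse_fps_no_geometric_bound[OF Q0 this bound]
    have "1 \<le> (B * j)\<^sup>2 * cmod (of_real e)" by simp
    then have "1 / e \<le> (B * j)\<^sup>2" using e by (simp add: field_simps)
    then have "sqrt (1 / e) \<le> sqrt ((B * j)\<^sup>2)" by (rule real_sqrt_le_mono)
    then have "1 / sqrt e \<le> B * j" using B real by (simp add: real_sqrt_divide)
    then show ?thesis using B real by (simp add: ennreal_mult[symmetric] ennreal_leI)
  qed (use B in \<open>simp add: ennreal_mult_top\<close>)
  then show ?thesis by (simp add: B_def J_def)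
qed

text \<open>The line estimate holds for every base direction \<open>v\<close> and every centre
  \<open>\<mu>\<close>. With the centre \<open>- v \<bullet> u\<close> and \<open>v\<close>
  Gaussian, \<open>v + g u\<close> is a resampled Gaussian vector, so the direction towards
  \<open>y\<close> disappears from the bound.\<close>

lemma inverse_sqrt_dist_le:
  fixes c :: "('n::finite \<Rightarrow> nat) \<Rightarrow> real" and x y :: "real^'n"
  assumes px: "form_eval c d x \<noteq> 0" and py: "form_eval c d y = 0"
  shows "ennreal (1 / sqrt (dist x y)) \<le> ennreal (2 * sqrt (2 / sqrt (2 * pi)))
    * (\<integral>\<^sup>+ v. ennreal (gauss_density 1 0 v) * root_proximity c d x v \<partial>lborel)"
proof -
  define B where "B = 2 * sqrt (2 / sqrt (2 * pi))"
  define e where "e = dist x y"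
  define u where "u = (1 / e) *\<^sub>R (y - x)"
  have e: "e > 0" using px py by (auto simp: e_def)
  have u: "norm u = 1" using e by (simp add: u_def e_def dist_norm norm_minus_commute)
  have y: "x + e *\<^sub>R u = y" using e by (simp add: u_def)
  have [measurable]: "(\<lambda>v. root_proximity c d x v) \<in> borel_measurable borel"
    using measurable_Pair2[OF borel_measurable_root_proximity, of x] by simp
  define I where "I = (\<lambda>v. \<integral>\<^sup>+ g. ennreal (normal_density ((0 - v) \<bullet> u) 1 g)
      * root_proximity c d x (v + g *\<^sub>R u) \<partial>lborel)"
  have [measurable]: "I \<in> borel_measurable borel"
    unfolding I_def normal_density_def by measurable
  have "ennreal (1 / sqrt e) = (\<integral>\<^sup>+ v. ennreal (gauss_density 1 0 (v :: real^'n)) * ennreal (1 / sqrt e) \<partial>lborel)"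
    by (simp add: nn_integral_multc nn_integral_gauss_density)
  also have "\<dots> \<le> (\<integral>\<^sup>+ v. ennreal (gauss_density 1 0 v) * (ennreal B * I v) \<partial>lborel)"
    using inverse_sqrt_dist_le_line[OF px _ e, of u] py unfolding B_def y I_def
    by (intro nn_integral_mono mult_left_mono) auto
  also have "\<dots> = (\<integral>\<^sup>+ v. ennreal B * (ennreal (gauss_density 1 0 v) * I v) \<partial>lborel)"
    by (simp only: mult.left_commute)
  also have "\<dots> = ennreal B * (\<integral>\<^sup>+ v. ennreal (gauss_density 1 0 v) * I v \<partial>lborel)"
    by (rule nn_integral_cmult) measurable
  also have "(\<integral>\<^sup>+ v. ennreal (gauss_density 1 0 v) * I v \<partial>lborel)
      = (\<integral>\<^sup>+ v. ennreal (gauss_density 1 0 v) * root_proximity c d x v \<partial>lborel)"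
    unfolding I_def by (rule gauss_resample[OF _ u, symmetric]) auto
  finally show ?thesis by (simp add: B_def e_def)
qed

section \<open>Mean inverse distance to the zero set\<close>

lemma finite_exponents: "finite {\<alpha>. sum \<alpha> (UNIV :: 'n::finite set) = (d::nat)}"
proof (rule finite_subset)
  show "{\<alpha>. sum \<alpha> (UNIV :: 'n set) = d} \<subseteq> UNIV \<rightarrow>\<^sub>E {..d}"
  proof
    fix \<alpha> :: "'n \<Rightarrow> nat" assume "\<alpha> \<in> {\<alpha>. sum \<alpha> UNIV = d}"
    then have "\<alpha> i \<le> d" for i using member_le_sum[of i UNIV \<alpha>] by simp
    then show "\<alpha> \<in> UNIV \<rightarrow>\<^sub>E {..d}" by (simp add: PiE_UNIV_domain)
  qed
  show "finite ((UNIV :: 'n set) \<rightarrow>\<^sub>E {..d})" by (intro finite_PiE) auto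
qed

text \<open>A polynomial that vanishes identically has zero coefficients, by separating one variable
  at a time. The family \<open>A\<close> is general because each step restricts it to exponents with
  a prescribed \<open>j\<close>-th entry; exponents agreeing on \<open>S\<close> are not separated,
  hence the sum.\<close>

lemma vanishing_monomial_sum:
  fixes c :: "('i \<Rightarrow> nat) \<Rightarrow> real"
  assumes "finite S" "finite A" "\<And>x. (\<Sum>\<alpha>\<in>A. c \<alpha> * (\<Prod>i\<in>S. x i ^ \<alpha> i)) = 0"
  shows "(\<Sum>\<alpha>\<in>{\<alpha>\<in>A. \<forall>i\<in>S. \<alpha> i = \<beta> i}. c \<alpha>) = 0"
  using assms
proof (induction S arbitrary: A rule: finite_induct)
  case empty
  then show ?case by simp
next
  case (insert j S)
  define A' where "A' = (\<lambda>m. {\<alpha>\<in>A. \<alpha> j = m})"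
  have "(\<Sum>\<alpha>\<in>A' (\<beta> j). c \<alpha> * (\<Prod>i\<in>S. x i ^ \<alpha> i)) = 0" for x
  proof -
    define R where "R = (\<Sum>\<alpha>\<in>A. monom (c \<alpha> * (\<Prod>i\<in>S. x i ^ \<alpha> i)) (\<alpha> j))"
    have "poly R t = 0" for t
    proof -
      have "(\<Sum>\<alpha>\<in>A. c \<alpha> * (\<Prod>i\<in>insert j S. (x(j := t)) i ^ \<alpha> i)) = 0"
        by (rule insert.prems(2))
      moreover have "(\<Prod>i\<in>S. (x(j := t)) i ^ \<alpha> i) = (\<Prod>i\<in>S. x i ^ \<alpha> i)" for \<alpha> :: "'i \<Rightarrow> nat"
        using insert.hyps by (intro prod.cong) auto
      ultimately show ?thesis
        using insert.hyps by (simp add: R_def poly_sum poly_monom mult_ac)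
    qed
    then have "R = 0" using poly_all_0_iff_0 by blast
    then have "coeff R (\<beta> j) = 0" by simp
    moreover have "coeff R (\<beta> j) = (\<Sum>\<alpha>\<in>A' (\<beta> j). c \<alpha> * (\<Prod>i\<in>S. x i ^ \<alpha> i))"
      unfolding R_def A'_def coeff_sum coeff_monom
      using insert.prems(1) by (subst sum.inter_filter) auto
    ultimately show ?thesis by simp
  qed
  then have "(\<Sum>\<alpha>\<in>{\<alpha>\<in>A' (\<beta> j). \<forall>i\<in>S. \<alpha> i = \<beta> i}. c \<alpha>) = 0"
    using insert.prems(1) by (intro insert.IH) (auto simp: A'_def)
  also have "{\<alpha>\<in>A' (\<beta> j). \<forall>i\<in>S. \<alpha> i = \<beta> i} = {\<alpha>\<in>A. \<forall>i\<in>insert j S. \<alpha> i = \<beta> i}"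
    by (auto simp: A'_def)
  finally show ?case .
qed

lemma form_eval_nonzero:
  fixes c :: "('n::finite \<Rightarrow> nat) \<Rightarrow> real"
  assumes "sum \<beta> UNIV = d" "c \<beta> \<noteq> 0"
  obtains x where "form_eval c d x \<noteq> 0"
proof (rule ccontr)
  assume "\<not> thesis"
  with that have zero: "form_eval c d x = 0" for x by blast
  have "(\<Sum>\<alpha>\<in>{\<alpha>. sum \<alpha> UNIV = d}. c \<alpha> * (\<Prod>i\<in>UNIV. x i ^ \<alpha> i)) = 0" for x
    using zero[of "\<chi> i. x i"] by (simp add: form_eval_def)
  then have "(\<Sum>\<alpha>\<in>{\<alpha>\<in>{\<alpha>. sum \<alpha> UNIV = d}. \<forall>i\<in>UNIV. \<alpha> i = \<beta> i}. c \<alpha>) = 0"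
    by (intro vanishing_monomial_sum finite_exponents) auto
  also have "{\<alpha>\<in>{\<alpha>. sum \<alpha> UNIV = d}. \<forall>i\<in>UNIV. \<alpha> i = \<beta> i} = {\<beta>}"
    using assms(1) by auto
  finally show False using assms(2) by simp
qed

lemma form_eval_scaleR:
  fixes c :: "('n::finite \<Rightarrow> nat) \<Rightarrow> real"
  shows "form_eval c d (r *\<^sub>R x) = r ^ d * form_eval c d x"
  unfolding form_eval_def sum_distrib_left
  by (intro sum.cong) (auto simp: power_mult_distrib prod.distrib power_sum)

text \<open>In a direction \<open>u\<close> with \<open>form_eval c d u \<noteq> 0\<close>, each
  parallel line meets the zero set in finitely many points. Resampling along \<open>u\<close> makes
  the zero set null for a Gaussian, and a positive density has the same null sets as
  \<open>lborel\<close>.\<close>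

lemma AE_form_eval_nonzero:
  fixes c :: "('n::finite \<Rightarrow> nat) \<Rightarrow> real"
  assumes "sum \<beta> UNIV = d" "c \<beta> \<noteq> 0" and d: "d \<ge> 1"
  shows "AE x in lborel. form_eval c d x \<noteq> 0"
proof -
  obtain v where v: "form_eval c d v \<noteq> 0"
    using form_eval_nonzero[where \<beta> = \<beta> and c = c and d = d] assms(1,2) by blast
  have "form_eval c d 0 = 0"
    using form_eval_scaleR[of c d 0 v] d by simp
  with v have v0: "v \<noteq> 0" by auto
  define u where "u = (1 / norm v) *\<^sub>R v"
  have u: "norm u = 1" using v0 by (simp add: u_def)
  have pu: "form_eval c d u \<noteq> 0" using v v0 by (simp add: u_def form_eval_scaleR)
  have [measurable]: "form_eval c d \<in> borel_measurable borel"
    using continuous_on_form_eval by (rule borel_measurable_continuous_onI)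
  define F where "F = (\<lambda>x. indicator {x. form_eval c d x = 0} x :: ennreal)"
  have [measurable]: "F \<in> borel_measurable borel"
    unfolding F_def by measurable
  have line: "(\<integral>\<^sup>+ r. ennreal (normal_density \<mu> 1 r) * F (x + r *\<^sub>R u) \<partial>lborel) = 0" for x \<mu>
  proof -
    obtain Q where Q: "degree Q \<le> d" "\<And>t. poly Q t = line_eval c d x u t"
      using line_poly[where x=x and u=u and c=c and d=d] by blast
    \<comment> \<open>If the form vanished on the whole line, homogeneity would make it vanish at
      \<open>s x + u\<close> for all \<open>s > 0\<close>, and \<open>s \<rightarrow> 0\<close>
      would give a zero at \<open>u\<close>.\<close>
    have "Q \<noteq> 0"
    proof
      assume "Q = 0"
      then have "form_eval c d (x + r *\<^sub>R u) = 0" for r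
        using Q(2)[of "of_real r"] by (simp add: line_eval_of_real)
      then have z: "form_eval c d (s *\<^sub>R x + u) = 0" if "s > 0" for s
        using form_eval_scaleR[of c d s "x + (1 / s) *\<^sub>R u"] that by (simp add: scaleR_add_right)
      have "isCont (\<lambda>s. form_eval c d (s *\<^sub>R x + u)) 0"
        unfolding form_eval_def by (intro continuous_intros)
      then have "((\<lambda>s. form_eval c d (s *\<^sub>R x + u)) \<longlongrightarrow> form_eval c d u) (at_right 0)"
        unfolding isCont_def by (auto intro: filterlim_mono at_le)
      moreover have "((\<lambda>s. form_eval c d (s *\<^sub>R x + u)) \<longlongrightarrow> 0) (at_right 0)"
        by (rule tendsto_eventually) (auto simp: eventually_at_right_less z
            intro: eventually_mono[OF eventually_at_right_less])
      ultimately show False using pu tendsto_unique trivial_limit_at_right_real by blast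
    qed
    then have "finite {t. poly Q t = 0}" by (rule poly_roots_finite)
    then have "finite (complex_of_real -` {t. poly Q t = 0})"
      by (rule finite_vimageI) (simp add: inj_of_real)
    then have "AE r in lborel. r \<notin> complex_of_real -` {t. poly Q t = 0}"
      by (intro AE_not_in finite_imp_null_set_lborel)
    then have "AE r in lborel. ennreal (normal_density \<mu> 1 r) * F (x + r *\<^sub>R u) = 0"
      by eventually_elim (simp add: Q line_eval_of_real F_def)
    then show ?thesis by (subst nn_integral_0_iff_AE) auto
  qed
  have "(\<integral>\<^sup>+ x. ennreal (gauss_density 1 (0 :: real^'n) x) * F x \<partial>lborel) = 0"
    using gauss_resample[OF _ u, of 1 F 0] by (simp add: line)
  then have "AE x in lborel. ennreal (gauss_density 1 (0 :: real^'n) x) * F x = 0"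
    by (subst (asm) nn_integral_0_iff_AE) auto
  then show ?thesis
  proof eventually_elim
    case (elim x)
    then show ?case using gauss_density_pos[of 1 0 x] by (auto simp: F_def)
  qed
qed

text \<open>Resample \<open>x\<close> along \<open>u = v / norm v\<close>. The roots seen from
  \<open>x + r u\<close> in direction \<open>v\<close> correspond to points
  \<open>r + t * norm v\<close> of one set \<open>A\<close> of at most \<open>d\<close> roots that
  does not depend on \<open>r\<close>. The factor \<open>sqrt (norm v)\<close> comes from rescaling
  the direction.\<close>

lemma nn_integral_root_proximity_le:
  fixes c :: "('n::finite \<Rightarrow> nat) \<Rightarrow> real" and v a :: "real^'n"
  assumes s: "\<sigma> > 0" and d: "d \<ge> 1" and v: "v \<noteq> 0"
    and AE: "AE x in lborel. form_eval c d x \<noteq> 0"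
  shows "(\<integral>\<^sup>+ x. ennreal (gauss_density \<sigma> a x) * root_proximity c d x v \<partial>lborel)
    \<le> ennreal (2 * sqrt (2 * real d / (\<sigma> * sqrt (2 * pi)))) * ennreal (sqrt (norm v))"
proof -
  define u where "u = (1 / norm v) *\<^sub>R v"
  have u: "norm u = 1" and vu: "v = norm v *\<^sub>R u" using v by (simp_all add: u_def)
  define K where "K = 2 * sqrt (2 * real d / (\<sigma> * sqrt (2 * pi)))"
  have [measurable]: "(\<lambda>x. root_proximity c d x v) \<in> borel_measurable borel"
    using measurable_Pair1[OF borel_measurable_root_proximity, of v] by simp
  have line: "(\<integral>\<^sup>+ r. ennreal (normal_density \<mu> \<sigma> r) * root_proximity c d (x + r *\<^sub>R u) v \<partial>lborel)
      \<le> ennreal K * ennreal (sqrt (norm v))" if px: "form_eval c d x \<noteq> 0" for x \<mu>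
  proof -
    obtain Q where Q: "degree Q \<le> d" "\<And>t. poly Q t = line_eval c d x u t"
      using line_poly[where x=x and u=u and c=c and d=d] by blast
    define A where "A = {t. poly Q t = 0}"
    have "poly Q 0 \<noteq> 0" using px by (simp add: Q line_eval_0)
    then have "Q \<noteq> 0" by auto
    then have A: "finite A" "card A \<le> d"
      using poly_roots_finite card_poly_roots_bound[of Q] Q(1) by (auto simp: A_def)
    have pw: "root_proximity c d (x + r *\<^sub>R u) v
        \<le> ennreal (sqrt (norm v)) * (SUP a\<in>A. inverse (ennreal (sqrt (cmod (complex_of_real r - a)))))" for r
      unfolding root_proximity_def
    proof (rule SUP_least)
      fix t assume t: "t \<in> {t. line_eval c d (x + r *\<^sub>R u) v t = 0}"
      define b where "b = complex_of_real r + t * complex_of_real (norm v)"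
      have "line_eval c d (x + r *\<^sub>R u) (norm v *\<^sub>R u) t = 0" using t vu by simp
      then have "b \<in> A" unfolding line_eval_affine A_def b_def using Q(2) by simp
      have "cmod (complex_of_real r - b) = cmod t * norm v"
        by (simp add: b_def norm_mult)
      then have cm: "sqrt (cmod (complex_of_real r - b)) = sqrt (cmod t) * sqrt (norm v)"
        by (simp add: real_sqrt_mult)
      have "inverse (ennreal (sqrt (cmod t)))
          = ennreal (sqrt (norm v)) * inverse (ennreal (sqrt (cmod (complex_of_real r - b))))"
      proof (cases "t = 0")
        case True
        then show ?thesis using v by (simp add: cm ennreal_mult_top)
      next
        case False
        then show ?thesis unfolding cm
          using v by (simp add: inverse_ennreal ennreal_mult[symmetric])
      qed
      also have "\<dots> \<le> ennreal (sqrt (norm v))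
          * (SUP a\<in>A. inverse (ennreal (sqrt (cmod (complex_of_real r - a)))))"
        using \<open>b \<in> A\<close> by (intro mult_left_mono SUP_upper) auto
      finally show "inverse (ennreal (sqrt (cmod t))) \<le> \<dots>" .
    qed
    have [measurable]: "(\<lambda>r. SUP a\<in>A. inverse (ennreal (sqrt (cmod (complex_of_real r - a))))) \<in> borel_measurable borel"
      using A(1) by (intro borel_measurable_SUP countable_finite) measurable
    have "(\<integral>\<^sup>+ r. ennreal (normal_density \<mu> \<sigma> r) * root_proximity c d (x + r *\<^sub>R u) v \<partial>lborel)
        \<le> (\<integral>\<^sup>+ r. ennreal (normal_density \<mu> \<sigma> r) * (ennreal (sqrt (norm v))
          * (SUP a\<in>A. inverse (ennreal (sqrt (cmod (complex_of_real r - a)))))) \<partial>lborel)"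
      by (intro nn_integral_mono mult_left_mono pw) auto
    also have "\<dots> = ennreal (sqrt (norm v)) * (\<integral>\<^sup>+ r. ennreal (normal_density \<mu> \<sigma> r)
          * (SUP a\<in>A. inverse (ennreal (sqrt (cmod (complex_of_real r - a))))) \<partial>lborel)"
      unfolding mult.left_commute[of _ "ennreal (sqrt (norm v))"]
      by (rule nn_integral_cmult) measurable
    also have "\<dots> \<le> ennreal (sqrt (norm v)) * ennreal K"
      unfolding K_def by (intro mult_left_mono normal_inverse_sqrt_dist_finite_set s A d) auto
    finally show ?thesis by (simp add: mult.commute)
  qed
  have "(\<integral>\<^sup>+ x. ennreal (gauss_density \<sigma> a x) * root_proximity c d x v \<partial>lborel)
    = (\<integral>\<^sup>+ x. ennreal (gauss_density \<sigma> a x) * (\<integral>\<^sup>+ r. ennreal (normal_density ((a - x) \<bullet> u) \<sigma> r)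
        * root_proximity c d (x + r *\<^sub>R u) v \<partial>lborel) \<partial>lborel)"
    by (rule gauss_resample[OF s u]) measurable
  also have "\<dots> \<le> (\<integral>\<^sup>+ x. ennreal (gauss_density \<sigma> a x) * (ennreal K * ennreal (sqrt (norm v))) \<partial>lborel)"
  proof (rule nn_integral_mono_AE)
    show "AE x in lborel. ennreal (gauss_density \<sigma> a x) * (\<integral>\<^sup>+ r. ennreal (normal_density ((a - x) \<bullet> u) \<sigma> r)
        * root_proximity c d (x + r *\<^sub>R u) v \<partial>lborel)
      \<le> ennreal (gauss_density \<sigma> a x) * (ennreal K * ennreal (sqrt (norm v)))"
      using AE by eventually_elim (intro mult_left_mono line, auto)
  qed
  also have "\<dots> = ennreal K * ennreal (sqrt (norm v))"
    by (simp add: nn_integral_multc nn_integral_gauss_density[OF s])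
  finally show ?thesis by (simp add: K_def)
qed

lemma nn_integral_gauss_sqrt_norm:
  "(\<integral>\<^sup>+ v. ennreal (gauss_density 1 0 (v :: real^'n)) * ennreal (sqrt (norm v)) \<partial>lborel)
    \<le> ennreal (sqrt (sqrt (real CARD('n))))"
proof -
  define n where "n = real CARD('n)"
  define q where "q = sqrt (sqrt n)"
  have n: "n > 0" by (simp add: n_def)
  have pow4: "z ^ 4 = (z\<^sup>2)\<^sup>2" for z :: real by simp
  have q: "q > 0" "q ^ 4 = n" unfolding pow4 using n by (simp_all add: q_def)
  \<comment> \<open>The tangent of the fourth root, as a function of \<open>y\<^sup>2\<close>, at
    the point \<open>q ^ 4 = n\<close>. As \<open>n\<close> is the mean of the squared norm,
    integrating it is Jensen's inequality.\<close>
  have pw: "sqrt y \<le> 3 / 4 * q + 1 / (4 * q ^ 3) * y\<^sup>2" if "y \<ge> 0" for y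
  proof -
    define z where "z = sqrt y / q"
    have z: "z \<ge> 0" "sqrt y = z * q" using q that by (auto simp: z_def)
    have "y\<^sup>2 = (sqrt y) ^ 4" unfolding pow4 using that by simp
    then have y2: "y\<^sup>2 = z ^ 4 * q ^ 4" by (simp add: z power_mult_distrib)
    have "z ^ 4 - 4 * z + 3 = (z - 1)\<^sup>2 * ((z + 1)\<^sup>2 + 2)"
      by (simp add: power4_eq_xxxx power2_eq_square algebra_simps)
    then have "4 * z \<le> z ^ 4 + 3" by (smt (verit) mult_nonneg_nonneg zero_le_power2)
    then have "4 * z * q \<le> (z ^ 4 + 3) * q" using q by (intro mult_right_mono) auto
    then have "z * q \<le> 3 / 4 * q + z ^ 4 * q / 4" by (simp add: algebra_simps)
    also have "z ^ 4 * q / 4 = 1 / (4 * q ^ 3) * (z ^ 4 * q ^ 4)"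
      using q by (simp add: field_simps power_numeral_reduce)
    finally show ?thesis unfolding z(2) y2 .
  qed
  have "(\<integral>\<^sup>+ v. ennreal (gauss_density 1 0 (v :: real^'n)) * ennreal (sqrt (norm v)) \<partial>lborel)
    \<le> (\<integral>\<^sup>+ v. ennreal (3 / 4 * q) * ennreal (gauss_density 1 0 (v :: real^'n))
        + ennreal (1 / (4 * q ^ 3)) * ennreal (gauss_density 1 0 v * (norm (v - 0))\<^sup>2) \<partial>lborel)"
  proof (intro nn_integral_mono)
    fix v :: "real^'n"
    have "ennreal (gauss_density 1 0 v * sqrt (norm v))
        \<le> ennreal (gauss_density 1 0 v * (3 / 4 * q + 1 / (4 * q ^ 3) * (norm v)\<^sup>2))"
      by (intro ennreal_leI mult_left_mono pw) (auto simp: gauss_density_nonneg)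
    also have "gauss_density 1 0 v * (3 / 4 * q + 1 / (4 * q ^ 3) * (norm v)\<^sup>2)
        = 3 / 4 * q * gauss_density 1 0 v + 1 / (4 * q ^ 3) * (gauss_density 1 0 v * (norm (v - 0))\<^sup>2)"
      by (simp add: algebra_simps)
    finally show "ennreal (gauss_density 1 0 v) * ennreal (sqrt (norm v))
        \<le> ennreal (3 / 4 * q) * ennreal (gauss_density 1 0 v)
        + ennreal (1 / (4 * q ^ 3)) * ennreal (gauss_density 1 0 v * (norm (v - 0))\<^sup>2)"
      using q by (simp add: ennreal_mult[symmetric] gauss_density_nonneg ennreal_plus[symmetric]
          del: ennreal_plus)
  qed
  also have "\<dots> = ennreal (3 / 4 * q) * 1 + ennreal (1 / (4 * q ^ 3)) * ennreal n"
    using nn_integral_gauss_second_moment[of 1 "0 :: real^'n" 0]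
    by (simp add: nn_integral_add nn_integral_cmult nn_integral_gauss_density n_def)
  also have "\<dots> = ennreal (3 / 4 * q + 1 / (4 * q ^ 3) * n)"
    using q n by (simp add: ennreal_mult[symmetric] ennreal_plus[symmetric] del: ennreal_plus)
  also have "3 / 4 * q + 1 / (4 * q ^ 3) * n = q"
    unfolding q(2)[symmetric] using q(1) by (simp add: field_simps power_numeral_reduce)
  finally show ?thesis by (simp add: q_def n_def)
qed

text \<open>A nearest point of \<open>S\<close> exists and is a zero of the form, so
  \<open>inverse_sqrt_dist_le\<close> applies at almost every \<open>x\<close>. Exchanging the
  integrals lets \<open>x\<close> be averaged for a fixed direction; the last factor is the mean of
  \<open>sqrt (norm v)\<close>.\<close>

lemma nn_integral_inverse_sqrt_infdist:
  fixes c :: "('n::finite \<Rightarrow> nat) \<Rightarrow> real" and S :: "(real^'n) set" and a :: "real^'n"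
  assumes s: "\<sigma> > 0" and d: "d \<ge> 1"
    and AE: "AE x in lborel. form_eval c d x \<noteq> 0"
    and S: "closed S" "S \<noteq> {}" "\<And>y. y \<in> S \<Longrightarrow> form_eval c d y = 0"
  shows "(\<integral>\<^sup>+ x. ennreal (gauss_density \<sigma> a x) * ennreal (1 / sqrt (infdist x S)) \<partial>lborel)
    \<le> ennreal (4 * sqrt (2 * real d * sqrt (real CARD('n)) / (pi * \<sigma>)))"
proof -
  define B where "B = 2 * sqrt (2 / sqrt (2 * pi))"
  define K where "K = 2 * sqrt (2 * real d / (\<sigma> * sqrt (2 * pi)))"
  have BK: "B \<ge> 0" "K \<ge> 0" using s by (simp_all add: B_def K_def)
  note [measurable] = borel_measurable_root_proximity
  have "(\<integral>\<^sup>+ x. ennreal (gauss_density \<sigma> a x) * ennreal (1 / sqrt (infdist x S)) \<partial>lborel)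
    \<le> (\<integral>\<^sup>+ x. ennreal (gauss_density \<sigma> a x) * (ennreal B
        * (\<integral>\<^sup>+ v. ennreal (gauss_density 1 0 v) * root_proximity c d x v \<partial>lborel)) \<partial>lborel)"
  proof (rule nn_integral_mono_AE)
    show "AE x in lborel. ennreal (gauss_density \<sigma> a x) * ennreal (1 / sqrt (infdist x S))
      \<le> ennreal (gauss_density \<sigma> a x) * (ennreal B
        * (\<integral>\<^sup>+ v. ennreal (gauss_density 1 0 v) * root_proximity c d x v \<partial>lborel))"
      using AE
    proof eventually_elim
      case (elim x)
      obtain y where y: "y \<in> S" "infdist x S = dist x y"
        using infdist_attains_inf[OF S(1,2)] by blast
      show ?case unfolding y(2) B_def
        by (intro mult_left_mono inverse_sqrt_dist_le elim S(3) y(1)) auto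
    qed
  qed
  also have "\<dots> = (\<integral>\<^sup>+ x. (\<integral>\<^sup>+ v. ennreal B * (ennreal (gauss_density 1 0 v)
      * (ennreal (gauss_density \<sigma> a x) * root_proximity c d x v)) \<partial>lborel) \<partial>lborel)"
    by (intro nn_integral_cong) (simp add: nn_integral_cmult[symmetric] mult_ac)
  also have "\<dots> = (\<integral>\<^sup>+ v. (\<integral>\<^sup>+ x. ennreal B * (ennreal (gauss_density 1 0 v)
      * (ennreal (gauss_density \<sigma> a x) * root_proximity c d x v)) \<partial>lborel) \<partial>lborel)"
    by (rule lborel_pair.Fubini') measurable
  also have "\<dots> = (\<integral>\<^sup>+ v. ennreal B * (ennreal (gauss_density 1 0 v)
      * (\<integral>\<^sup>+ x. ennreal (gauss_density \<sigma> a x) * root_proximity c d x v \<partial>lborel)) \<partial>lborel)"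
    by (intro nn_integral_cong) (simp add: nn_integral_cmult)
  also have "\<dots> \<le> (\<integral>\<^sup>+ v. ennreal B * (ennreal (gauss_density 1 (0 :: real^'n) v)
      * (ennreal K * ennreal (sqrt (norm v)))) \<partial>lborel)"
  proof (rule nn_integral_mono_AE)
    have "AE v in lborel. v \<notin> {0 :: real^'n}"
      by (intro AE_not_in finite_imp_null_set_lborel) simp
    then show "AE v in lborel. ennreal B * (ennreal (gauss_density 1 0 v)
        * (\<integral>\<^sup>+ x. ennreal (gauss_density \<sigma> a x) * root_proximity c d x v \<partial>lborel))
      \<le> ennreal B * (ennreal (gauss_density 1 0 v) * (ennreal K * ennreal (sqrt (norm v))))"
      unfolding K_def
      by eventually_elim (intro mult_left_mono nn_integral_root_proximity_le s d AE, auto)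
  qed
  also have "\<dots> = (\<integral>\<^sup>+ v. (ennreal B * ennreal K) * (ennreal (gauss_density 1 (0 :: real^'n) v)
      * ennreal (sqrt (norm v))) \<partial>lborel)"
    by (simp only: mult_ac)
  also have "\<dots> = (ennreal B * ennreal K) * (\<integral>\<^sup>+ v. ennreal (gauss_density 1 (0 :: real^'n) v)
      * ennreal (sqrt (norm v)) \<partial>lborel)"
    by (rule nn_integral_cmult) measurable
  also have "\<dots> \<le> (ennreal B * ennreal K) * ennreal (sqrt (sqrt (real CARD('n))))"
    by (intro mult_left_mono nn_integral_gauss_sqrt_norm) auto
  also have "\<dots> = ennreal (B * K * sqrt (sqrt (real CARD('n))))"
    using BK by (simp add: ennreal_mult)
  also have "B * K * sqrt (sqrt (real CARD('n)))
      = 4 * sqrt (2 / sqrt (2 * pi) * (2 * real d / (\<sigma> * sqrt (2 * pi))) * sqrt (real CARD('n)))"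
    by (simp add: B_def K_def real_sqrt_mult[symmetric] mult_ac)
  also have "2 / sqrt (2 * pi) * (2 * real d / (\<sigma> * sqrt (2 * pi))) = 2 * real d / (pi * \<sigma>)"
  proof -
    define q where "q = sqrt (2 * pi)"
    have "q * q = 2 * pi" by (simp add: q_def)
    moreover have "2 / q * (2 * real d / (\<sigma> * q)) = 4 * real d / (\<sigma> * (q * q))" by simp
    ultimately show ?thesis by (simp add: q_def mult.commute)
  qed
  also have "2 * real d / (pi * \<sigma>) * sqrt (real CARD('n)) = 2 * real d * sqrt (real CARD('n)) / (pi * \<sigma>)"
    by simp
  finally show ?thesis .
qed

section \<open>The two bounds for the mean logarithm\<close>

lemma ln_le_tangent:
  assumes "x > 0" "c > (0::real)"
  shows "ln x \<le> x / c + ln c - 1"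
  using ln_le_minus_one[of "x / c"] assms by (simp add: ln_div)

text \<open>Both bounds below integrate a majorant of this shape; \<open>e\<close> is the origin in
  the global bound and the centre of the Gaussian in the local one. Non-negative coefficients let
  the integral split in \<open>ennreal\<close>.\<close>

lemma nn_integral_ln_cond_num_le:
  fixes S :: "(real^'n) set" and a e :: "real^'n"
  assumes s: "\<sigma> > 0" and S: "closed S" "S \<noteq> {}"
    and AE: "AE x in lborel. x \<notin> S"
    and I: "(\<integral>\<^sup>+ x. ennreal (gauss_density \<sigma> a x) * ennreal (1 / sqrt (infdist x S)) \<partial>lborel) \<le> ennreal M"
    and nonneg: "\<alpha> \<ge> 0" "\<beta> \<ge> 0" "\<gamma> \<ge> 0" "M \<ge> 0"
    and le: "\<And>x. infdist x S > 0 \<Longrightarrow> ln (norm x / infdist x S)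
        \<le> \<alpha> + \<beta> * (norm (x - e))\<^sup>2 + \<gamma> * (1 / sqrt (infdist x S))"
  shows "(\<integral>\<^sup>+ x. ennreal (gauss_density \<sigma> a x) * ln_cond_num S x \<partial>lborel)
    \<le> ennreal (\<alpha> + \<beta> * (real CARD('n) * \<sigma>\<^sup>2 + (norm (a - e))\<^sup>2) + \<gamma> * M)"
proof -
  define G where "G = (\<lambda>x. gauss_density \<sigma> a x)"
  define y where "y = (\<lambda>x. 1 / sqrt (infdist x S))"
  have [measurable]: "(\<lambda>x. infdist x S) \<in> borel_measurable borel"
    by (intro borel_measurable_continuous_onI continuous_on_infdist continuous_on_id)
  have [measurable]: "G \<in> borel_measurable borel" "y \<in> borel_measurable borel"
    unfolding G_def y_def by measurable
  have G0: "G x \<ge> 0" for x by (simp add: G_def gauss_density_nonneg)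
  have y0: "y x \<ge> 0" for x by (simp add: y_def infdist_nonneg)
  have "(\<integral>\<^sup>+ x. ennreal (G x) * ln_cond_num S x \<partial>lborel)
    \<le> (\<integral>\<^sup>+ x. ennreal \<alpha> * ennreal (G x) + ennreal \<beta> * ennreal (G x * (norm (x - e))\<^sup>2)
        + ennreal \<gamma> * (ennreal (G x) * ennreal (y x)) \<partial>lborel)"
  proof (rule nn_integral_mono_AE)
    show "AE x in lborel. ennreal (G x) * ln_cond_num S x
      \<le> ennreal \<alpha> * ennreal (G x) + ennreal \<beta> * ennreal (G x * (norm (x - e))\<^sup>2)
        + ennreal \<gamma> * (ennreal (G x) * ennreal (y x))"
      using AE
    proof eventually_elim
      case (elim x)
      then have pos: "infdist x S > 0"
        using S in_closed_iff_infdist_zero[of S x] infdist_nonneg[of x S] by fastforce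
      have "ln_cond_num S x = ennreal (ln (norm x / infdist x S))"
        using pos by (simp add: ln_cond_num_def cond_num_def)
      also have "\<dots> \<le> ennreal (\<alpha> + \<beta> * (norm (x - e))\<^sup>2 + \<gamma> * y x)"
        using le[OF pos] by (intro ennreal_leI) (simp add: y_def)
      finally have "ennreal (G x) * ln_cond_num S x
          \<le> ennreal (G x) * ennreal (\<alpha> + \<beta> * (norm (x - e))\<^sup>2 + \<gamma> * y x)"
        by (rule mult_left_mono) simp
      also have "\<dots> = ennreal (\<alpha> * G x + \<beta> * (G x * (norm (x - e))\<^sup>2) + \<gamma> * (G x * y x))"
        using G0 y0 nonneg by (subst ennreal_mult[symmetric]) (auto simp: algebra_simps)
      also have "\<dots> = ennreal \<alpha> * ennreal (G x) + ennreal \<beta> * ennreal (G x * (norm (x - e))\<^sup>2)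
        + ennreal \<gamma> * (ennreal (G x) * ennreal (y x))"
        using G0 y0 nonneg by (simp add: ennreal_mult[symmetric] ennreal_plus[symmetric] del: ennreal_plus)
      finally show ?case .
    qed
  qed
  also have "\<dots> = ennreal \<alpha> * (\<integral>\<^sup>+ x. ennreal (G x) \<partial>lborel)
      + ennreal \<beta> * (\<integral>\<^sup>+ x. ennreal (G x * (norm (x - e))\<^sup>2) \<partial>lborel)
      + ennreal \<gamma> * (\<integral>\<^sup>+ x. ennreal (G x) * ennreal (y x) \<partial>lborel)"
    by (simp add: nn_integral_add nn_integral_cmult)
  also have "\<dots> \<le> ennreal \<alpha> * 1 + ennreal \<beta> * ennreal (real CARD('n) * \<sigma>\<^sup>2 + (norm (a - e))\<^sup>2)
      + ennreal \<gamma> * ennreal M"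
    using I unfolding G_def y_def
    by (intro add_mono mult_left_mono)
      (auto simp: nn_integral_gauss_density[OF s] nn_integral_gauss_second_moment[OF s])
  also have "\<dots> = ennreal (\<alpha> + \<beta> * (real CARD('n) * \<sigma>\<^sup>2 + (norm (a - e))\<^sup>2) + \<gamma> * M)"
    using nonneg by (simp add: ennreal_mult[symmetric] ennreal_plus[symmetric] del: ennreal_plus)
  finally show ?thesis by (simp add: G_def)
qed

text \<open>Jensen's inequality through tangents: \<open>ln (norm x)\<close> is half the logarithm
  of the squared norm, with tangent at its mean \<open>m\<close>, and
  \<open>- ln (infdist x S)\<close> is twice the logarithm of the inverse square root, with tangent
  at \<open>M\<close>. The tangents contribute \<open>- 1 / 2\<close> and \<open>- 2\<close>;
  \<open>large\<close> keeps the constant term non-negative.\<close>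

lemma ln_cond_num_global_bound:
  fixes S :: "(real^'n) set" and a :: "real^'n"
  assumes s: "\<sigma> > 0" and S: "closed S" "0 \<in> S"
    and AE: "AE x in lborel. x \<notin> S"
    and I: "(\<integral>\<^sup>+ x. ennreal (gauss_density \<sigma> a x) * ennreal (1 / sqrt (infdist x S)) \<partial>lborel) \<le> ennreal M"
    and a: "norm a = 1"
    and M: "M > 0" and large: "5 / 2 \<le> ln (1 + real CARD('n) * \<sigma>\<^sup>2) / 2 + 2 * ln M"
  shows "(\<integral>\<^sup>+ x. ennreal (gauss_density \<sigma> a x) * ln_cond_num S x \<partial>lborel)
    \<le> ennreal (ln (1 + real CARD('n) * \<sigma>\<^sup>2) / 2 + 2 * ln M)"
proof -
  define m where "m = 1 + real CARD('n) * \<sigma>\<^sup>2"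
  have m: "m > 0" by (simp add: m_def add_pos_nonneg)
  have "(\<integral>\<^sup>+ x. ennreal (gauss_density \<sigma> a x) * ln_cond_num S x \<partial>lborel)
    \<le> ennreal ((ln m / 2 + 2 * ln M - 5 / 2)
        + 1 / (2 * m) * (real CARD('n) * \<sigma>\<^sup>2 + (norm (a - 0))\<^sup>2) + 2 / M * M)"
  proof (rule nn_integral_ln_cond_num_le[OF s S(1) _ AE I])
    fix x assume pos: "infdist x S > 0"
    have x: "norm x > 0" using pos S(2) by (cases "x = 0") auto
    have "ln (norm x) = ln ((norm x)\<^sup>2) / 2" using x by (simp add: ln_realpow)
    also have "\<dots> \<le> ((norm x)\<^sup>2 / m + ln m - 1) / 2"
      using ln_le_tangent[of "(norm x)\<^sup>2" m] x m by (intro divide_right_mono) auto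
    finally have 1: "ln (norm x) \<le> (norm x)\<^sup>2 / (2 * m) + ln m / 2 - 1 / 2" by (simp add: field_simps)
    have 2: "- ln (infdist x S) \<le> 2 * (1 / sqrt (infdist x S) / M + ln M - 1)"
      using ln_le_tangent[of "1 / sqrt (infdist x S)" M] M pos by (simp add: ln_div ln_sqrt)
    show "ln (norm x / infdist x S) \<le> (ln m / 2 + 2 * ln M - 5 / 2) + 1 / (2 * m) * (norm (x - 0))\<^sup>2
        + 2 / M * (1 / sqrt (infdist x S))"
      using 1 2 x pos by (simp add: ln_div mult.commute[of M])
  qed (use S m M large in \<open>auto simp: m_def\<close>)
  also have "1 / (2 * m) * (real CARD('n) * \<sigma>\<^sup>2 + (norm (a - 0))\<^sup>2) = 1 / 2"
    using m a by (simp add: m_def add.commute)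
  finally show ?thesis using M by (simp add: m_def)
qed

text \<open>Here \<open>q\<close> is the mean of \<open>(2 * C * norm (x - a))\<^sup>2\<close>,
  Chebyshev's bound for leaving the ball of radius \<open>1 / (2 * C)\<close>. On the ball the
  distance to \<open>S\<close> is at least \<open>1 / (2 * C)\<close> and the norm at most
  \<open>3 / 2\<close>; outside, constants may be multiplied by
  \<open>(2 * C * z)\<^sup>2 \<ge> 1\<close>.\<close>

lemma ln_cond_num_local_bound:
  fixes S :: "(real^'n) set" and a :: "real^'n"
  assumes s: "\<sigma> > 0" and S: "closed S" "0 \<in> S"
    and AE: "AE x in lborel. x \<notin> S"
    and I: "(\<integral>\<^sup>+ x. ennreal (gauss_density \<sigma> a x) * ennreal (1 / sqrt (infdist x S)) \<partial>lborel) \<le> ennreal M"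
    and a: "norm a = 1" and C: "infdist a S = 1 / C" "C \<ge> 1"
    and M: "M > 0" and q: "q = (2 * C)\<^sup>2 * (real CARD('n) * \<sigma>\<^sup>2)" "q > 0"
    and large: "1 \<le> ln (M / q)"
  shows "(\<integral>\<^sup>+ x. ennreal (gauss_density \<sigma> a x) * ln_cond_num S x \<partial>lborel)
    \<le> ennreal (ln (3 * C) + q / (2 * C) + 2 * q * ln (M / q))"
proof -
  \<comment> \<open>The point of tangency that minimises
    \<open>2 * (ln k - 1) * q + 2 / k * M\<close>. The hypothesis \<open>large\<close> makes
    \<open>ln k - 1\<close> non-negative.\<close>
  define k where "k = M / q"
  have k: "k > 0" using M q by (simp add: k_def)
  have "(\<integral>\<^sup>+ x. ennreal (gauss_density \<sigma> a x) * ln_cond_num S x \<partial>lborel)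
    \<le> ennreal (ln (3 * C) + (2 * C + 2 * (ln k - 1) * (2 * C)\<^sup>2)
         * (real CARD('n) * \<sigma>\<^sup>2 + (norm (a - a))\<^sup>2) + 2 / k * M)"
  proof (rule nn_integral_ln_cond_num_le[OF s S(1) _ AE I])
    fix x assume pos: "infdist x S > 0"
    define z where "z = norm (x - a)"
    define y where "y = 1 / sqrt (infdist x S)"
    have z0: "z \<ge> 0" and y0: "y \<ge> 0" using pos by (auto simp: z_def y_def)
    have x: "norm x > 0" using pos S(2) by (cases "x = 0") auto
    have xz: "norm x \<le> 1 + z" using norm_triangle_ineq[of a "x - a"] a by (simp add: z_def)
    have k1: "ln k - 1 \<ge> 0" using large by (simp add: k_def)
    have c3: "ln (3 * C) \<ge> 0" using C(2) by simp
    have "ln (norm x / infdist x S)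
        \<le> ln (3 * C) + (2 * C * z\<^sup>2 + 2 * (ln k - 1) * ((2 * C)\<^sup>2 * z\<^sup>2)) + 2 / k * y"
    proof (cases "z \<le> 1 / (2 * C)")
      case True
      have "infdist a S \<le> infdist x S + dist a x" by (rule infdist_triangle)
      then have "1 / C \<le> infdist x S + 1 / (2 * C)"
        using C True by (simp add: z_def dist_norm norm_minus_commute)
      then have dx: "infdist x S \<ge> 1 / (2 * C)" by (simp add: field_simps)
      have "1 / (2 * C) \<le> 1 / 2" using C by (simp add: field_simps)
      then have "norm x \<le> 3 / 2" using xz True by linarith
      then have "norm x / infdist x S \<le> (3 / 2) / (1 / (2 * C))"
        using dx C by (intro frac_le) auto
      then have "ln (norm x / infdist x S) \<le> ln (3 * C)"
        using x pos C by (subst ln_le_cancel_iff) auto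
      moreover have "0 \<le> 2 * C * z\<^sup>2 + 2 * (ln k - 1) * ((2 * C)\<^sup>2 * z\<^sup>2)" "0 \<le> 2 / k * y"
        using C k1 k y0 by simp_all
      ultimately show ?thesis by linarith
    next
      case False
      then have Cz: "1 \<le> 2 * C * z" using C by (simp add: field_simps)
      have "ln (norm x) \<le> ln (1 + z)" using x xz z0 by (subst ln_le_cancel_iff) auto
      also have "\<dots> \<le> z" using z0 by (rule ln_add_one_self_le_self)
      also have "\<dots> \<le> (2 * C * z) * z" using mult_right_mono[OF Cz z0] by simp
      finally have 1: "ln (norm x) \<le> 2 * C * z\<^sup>2" by (simp add: power2_eq_square mult.assoc)
      have "1\<^sup>2 \<le> (2 * C * z)\<^sup>2" using Cz by (intro power_mono) auto
      define X where "X = (2 * C)\<^sup>2 * z\<^sup>2"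
      define L where "L = ln k - 1"
      define Y where "Y = y / k"
      define P where "P = L * X"
      from \<open>1\<^sup>2 \<le> (2 * C * z)\<^sup>2\<close> have "L * 1 \<le> L * X"
        using k1 unfolding X_def L_def by (intro mult_left_mono) (auto simp: power_mult_distrib)
      then have "L \<le> P" by (simp only: P_def mult_1_right)
      moreover have "- ln (infdist x S) \<le> 2 * Y + 2 * L"
        using ln_le_tangent[of y k] k pos by (simp add: y_def L_def Y_def ln_div ln_sqrt)
      moreover have "ln (norm x / infdist x S) = ln (norm x) - ln (infdist x S)"
        using x pos by (simp add: ln_div)
      ultimately have "ln (norm x / infdist x S) \<le> ln (3 * C) + (2 * C * z\<^sup>2 + 2 * P) + 2 * Y"
        using 1 c3 by linarith
      also have "2 * P = 2 * L * X" by (simp add: P_def)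
      also have "2 * Y = 2 / k * y" by (simp add: Y_def)
      finally show ?thesis by (simp add: X_def L_def)
    qed
    then show "ln (norm x / infdist x S) \<le> ln (3 * C)
        + (2 * C + 2 * (ln k - 1) * (2 * C)\<^sup>2) * (norm (x - a))\<^sup>2 + 2 / k * (1 / sqrt (infdist x S))"
      unfolding z_def y_def by (simp add: algebra_simps)
  qed (use S C M q(2) k large in \<open>auto simp: k_def\<close>)
  also have "(2 * C + 2 * (ln k - 1) * (2 * C)\<^sup>2) * (real CARD('n) * \<sigma>\<^sup>2 + (norm (a - a))\<^sup>2)
      = q / (2 * C) + 2 * (ln k - 1) * q"
    using C unfolding q(1) by (simp add: field_simps power2_eq_square)
  also have "2 / k * M = 2 * q" using M q(2) by (simp add: k_def)
  finally show ?thesis by (simp add: k_def algebra_simps)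
qed

section \<open>Comparison with the bound \<open>H_bound\<close>\<close>

text \<open>Since \<open>- ln \<epsilon>\<close> is non-negative, the third entry of the middle
  minimum in \<open>H_bound\<close> can be estimated from below by comparing powers only.\<close>

lemma entropy_term_ge:
  assumes e: "0 < \<epsilon>" "\<epsilon> < 1" and N: "N \<ge> 1" and y: "y \<ge> 1" and A: "y ^ N \<le> (A::real)"
  shows "\<epsilon> * ln y \<le> \<epsilon> / real N * (ln A - ln \<epsilon>)"
proof -
  have yN: "y ^ N > 0" using y by simp
  have "real N * ln y = ln (y ^ N)" using y by (simp add: ln_realpow)
  also have "\<dots> \<le> ln A" using yN A by (subst ln_le_cancel_iff) auto
  also have "\<dots> \<le> ln A - ln \<epsilon>" using e by simp
  finally have "real N * ln y \<le> ln A - ln \<epsilon>" .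
  then have "\<epsilon> / real N * (real N * ln y) \<le> \<epsilon> / real N * (ln A - ln \<epsilon>)"
    using e by (intro mult_left_mono) auto
  then show ?thesis using N by simp
qed

lemma exp_neg_inverse_le:
  assumes "\<sigma> > (0::real)"
  shows "exp (- 1 / (2 * \<sigma>\<^sup>2)) \<le> 2 * \<sigma>\<^sup>2"
proof -
  define r where "r = 1 / (2 * \<sigma>\<^sup>2)"
  have r: "r > 0" using assms by (simp add: r_def)
  have "r \<le> exp r" using exp_ge_add_one_self[of r] by linarith
  then have "exp (- r) \<le> 1 / r" using r by (simp add: exp_minus field_simps)
  then show ?thesis by (simp add: r_def)
qed

lemma H_bound_global:
  assumes N: "N \<ge> 6" and d: "d \<ge> 1" and s: "\<sigma> > 0" and C: "C \<ge> 1"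
    and t: "t = \<sigma> * sqrt (real N + 1)" and large: "2 * C * t > 1 / 2"
  shows "ln (1 + t\<^sup>2) / 2 + 2 * ln (4 * sqrt (2 * real d * (real N + 1) / (pi * t))) \<le> H_bound N d \<sigma> C"
proof -
  define n where "n = real N + 1"
  have n: "n \<ge> 7" "n \<le> 7 / 6 * real N" using N by (simp_all add: n_def)
  have tpos: "t > 0" using s by (simp add: t)
  have st: "\<sigma> \<le> t" "\<sigma>\<^sup>2 = t\<^sup>2 / n"
  proof -
    have "\<sigma> * 1 \<le> \<sigma> * sqrt n" using s n by (intro mult_left_mono) auto
    then show "\<sigma> \<le> t" by (simp add: t n_def)
    show "\<sigma>\<^sup>2 = t\<^sup>2 / n" using n by (simp add: t n_def power_mult_distrib)
  qed
  define \<epsilon> where "\<epsilon> = 1 - exp (- 1 / (2 * \<sigma>\<^sup>2))"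
  define A where "A = 2 ^ (N - 1) + 1 / \<sigma> ^ (N + 1)"
  have e: "0 < \<epsilon>" "\<epsilon> < 1" using s by (simp_all add: \<epsilon>_def)
  have lnC: "ln C \<ge> 0" using C by simp
  have A1: "A \<ge> 1" using s one_le_power[of "2::real" "N - 1"] by (simp add: A_def add_increasing2)
  have piCt: "1 \<le> 4 * pi * C * t"
  proof -
    have "1 \<le> 3 * (4 * C * t)" using large by simp
    also have "\<dots> \<le> pi * (4 * C * t)" using pi_gt3 C tpos by (intro mult_right_mono) auto
    finally show ?thesis by (simp add: mult_ac)
  qed
  define h where "h = min (\<epsilon> * ln C) (min (4 * pi * \<sigma> * C * sqrt (real N + 1) * ln C)
      (\<epsilon> / real N * (ln A - ln \<epsilon>)))"
  have H: "h + ln (real N * real d) + 3 * ln 2 + 2 \<le> H_bound N d \<sigma> C"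
  proof -
    have "1 \<le> exp (- 1 / (2 * \<sigma>\<^sup>2)) + 4 * pi * C * \<sigma> * sqrt (real N + 1)"
      using piCt by (simp add: t mult.assoc add_increasing)
    then have "min 1 (exp (- 1 / (2 * \<sigma>\<^sup>2)) + 4 * pi * C * \<sigma> * sqrt (real N + 1)) = 1" by simp
    moreover have "0 \<le> ln C * min \<epsilon> (A / (2 * C) ^ N)"
      using lnC e A1 C by (intro mult_nonneg_nonneg) auto
    ultimately show ?thesis
      unfolding H_bound_def Let_def h_def \<epsilon>_def[symmetric] A_def[symmetric] by simp
  qed
  have h_ge: "\<epsilon> * ln y \<le> h" if y: "1 \<le> y" "y \<le> C" "y ^ N \<le> A" for y
  proof -
    have 1: "\<epsilon> * ln y \<le> \<epsilon> * ln C" using y e by (intro mult_left_mono) auto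
    also have "\<epsilon> * ln C \<le> (4 * pi * C * t) * ln C" using piCt e lnC by (intro mult_right_mono) auto
    finally have 2: "\<epsilon> * ln y \<le> 4 * pi * \<sigma> * C * sqrt (real N + 1) * ln C" by (simp add: t mult_ac)
    have 3: "\<epsilon> * ln y \<le> \<epsilon> / real N * (ln A - ln \<epsilon>)" using e N y by (intro entropy_term_ge) auto
    show ?thesis unfolding h_def using 1 2 3 by simp
  qed
  have Nd: "real N * real d > 0" using N d by simp
  have sqrt_t: "sqrt (1 + t\<^sup>2) > 0" by (simp add: add_pos_nonneg)
  define X where "X = 4 * sqrt (2 * real d * n / (pi * t))"
  have X: "X > 0" using tpos n d by (simp add: X_def)
  have "ln (1 + t\<^sup>2) / 2 + 2 * ln X = ln (sqrt (1 + t\<^sup>2)) + ln (X\<^sup>2)"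
    using X by (simp add: ln_sqrt ln_realpow add_pos_nonneg)
  also have "\<dots> = ln (sqrt (1 + t\<^sup>2) * X\<^sup>2)"
    using sqrt_t X by (subst ln_mult) auto
  also have "X\<^sup>2 = 32 * real d * n / (pi * t)"
    using tpos n by (simp add: X_def power_mult_distrib)
  also have "ln (sqrt (1 + t\<^sup>2) * (32 * real d * n / (pi * t)))
      \<le> ln (real N * real d * (112 / 9 * (sqrt (1 + t\<^sup>2) / t)))"
  proof (subst ln_le_cancel_iff)
    have "32 * real d * n / (pi * t) \<le> 32 * real d * (7 / 6 * real N) / (3 * t)"
      using n tpos pi_gt3 by (intro frac_le mult_left_mono mult_right_mono) auto
    then have "sqrt (1 + t\<^sup>2) * (32 * real d * n / (pi * t))
        \<le> sqrt (1 + t\<^sup>2) * (32 * real d * (7 / 6 * real N) / (3 * t))"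
      using sqrt_t by (intro mult_left_mono) auto
    then show "sqrt (1 + t\<^sup>2) * (32 * real d * n / (pi * t))
        \<le> real N * real d * (112 / 9 * (sqrt (1 + t\<^sup>2) / t))"
      by (simp add: field_simps)
    show "0 < real N * real d * (112 / 9 * (sqrt (1 + t\<^sup>2) / t))" using Nd sqrt_t tpos by simp
    show "0 < sqrt (1 + t\<^sup>2) * (32 * real d * n / (pi * t))" using sqrt_t tpos n d by simp
  qed
  also have "\<dots> = ln (real N * real d) + ln (112 / 9 * (sqrt (1 + t\<^sup>2) / t))"
    using Nd sqrt_t tpos by (subst ln_mult) auto
  finally have B: "ln (1 + t\<^sup>2) / 2 + 2 * ln (4 * sqrt (2 * real d * (real N + 1) / (pi * t)))
      \<le> ln (real N * real d) + ln (112 / 9 * (sqrt (1 + t\<^sup>2) / t))"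
    by (simp add: X_def n_def)
  \<comment> \<open>The value \<open>52\<close> covers both cases below,
    \<open>112 / 9 * 33 / 8\<close> and \<open>112 / 9 * 4 * 26 / 25\<close>; the factor
    \<open>112 / 9\<close> is \<open>32 * (7 / 6) / 3\<close>, from \<open>n \<le> 7 / 6 * N\<close>
    and \<open>pi > 3\<close>. The slack \<open>1 / 10\<close> is used in the second case.\<close>
  have const: "ln z \<le> 3 * ln 2 + 19 / 10" if "0 < z" "z \<le> 52" for z :: real
  proof -
    have "ln z \<le> ln (52 :: real)" using that by simp
    also have "ln (52 :: real) \<le> 52 / 2 ^ 6 + ln (2 ^ 6) - 1" by (rule ln_le_tangent) auto
    also have "ln ((2::real) ^ 6) = 6 * ln 2" by (subst ln_realpow) auto
    finally show ?thesis using ln2_le_25_over_36 by simp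
  qed
  have "ln (112 / 9 * (sqrt (1 + t\<^sup>2) / t)) \<le> h + 3 * ln 2 + 2"
  proof (cases "t \<ge> 1 / 4")
    case True
    have "sqrt (1 + t\<^sup>2) \<le> sqrt ((33 / 8 * t)\<^sup>2)"
    proof (rule real_sqrt_le_mono)
      have "(1 / 4)\<^sup>2 \<le> t\<^sup>2" using True by (intro power_mono) auto
      then show "1 + t\<^sup>2 \<le> (33 / 8 * t)\<^sup>2" by (simp add: power2_eq_square)
    qed
    also have "sqrt ((33 / 8 * t)\<^sup>2) = 33 / 8 * t" using tpos by (subst real_sqrt_abs) simp
    finally have "sqrt (1 + t\<^sup>2) / t \<le> 33 / 8" using tpos by (simp add: field_simps)
    then have "ln (112 / 9 * (sqrt (1 + t\<^sup>2) / t)) \<le> 3 * ln 2 + 19 / 10"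
      using sqrt_t tpos by (intro const) auto
    moreover have "0 \<le> h" using h_ge[of 1] C A1 by simp
    ultimately show ?thesis by simp
  next
    case False
    \<comment> \<open>\<open>large\<close> says exactly that \<open>y < C\<close>, and
      \<open>\<sigma> \<le> t\<close> gives \<open>y \<le> 1 / \<sigma>\<close>, so \<open>h\<close>
      is at least \<open>\<epsilon> * ln y\<close>. The missing part
      \<open>(1 - \<epsilon>) * ln y\<close> is at most \<open>t / 14\<close>.\<close>
    define y where "y = 1 / (4 * t)"
    have y1: "1 \<le> y" using False tpos by (simp add: y_def field_simps)
    have yC: "y \<le> C" using large tpos by (simp add: y_def field_simps)
    have s1: "1 / \<sigma> \<ge> y"
      using st(1) s tpos unfolding y_def by (intro frac_le) auto
    have "y ^ N \<le> (1 / \<sigma>) ^ N" using s1 y1 by (intro power_mono) auto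
    also have "\<dots> \<le> (1 / \<sigma>) ^ (N + 1)" using s1 y1 by (intro power_increasing) auto
    also have "\<dots> \<le> A" by (simp add: A_def power_divide)
    finally have "\<epsilon> * ln y \<le> h" using y1 yC by (intro h_ge) auto
    moreover have "(1 - \<epsilon>) * ln y \<le> 1 / 50"
    proof -
      have "1 - \<epsilon> \<le> 2 * \<sigma>\<^sup>2" unfolding \<epsilon>_def using exp_neg_inverse_le[OF s] by simp
      also have "\<dots> \<le> 2 * t\<^sup>2 / 7"
        using n divide_left_mono[of 7 n "t\<^sup>2"] unfolding st(2) by simp
      finally have "1 - \<epsilon> \<le> 2 * t\<^sup>2 / 7" .
      moreover have "ln y \<le> y" using ln_le_minus_one[of y] y1 by simp
      ultimately have "(1 - \<epsilon>) * ln y \<le> (2 * t\<^sup>2 / 7) * y"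
        using e y1 by (intro mult_mono) auto
      also have "\<dots> = t / 14" using tpos by (simp add: y_def power2_eq_square)
      finally show ?thesis using False by simp
    qed
    moreover have "ln (112 / 9 * (sqrt (1 + t\<^sup>2) / t)) = ln y + ln (112 / 9 * 4 * sqrt (1 + t\<^sup>2))"
    proof -
      have "112 / 9 * (sqrt (1 + t\<^sup>2) / t) = y * (112 / 9 * 4 * sqrt (1 + t\<^sup>2))"
        using tpos by (simp add: y_def)
      then show ?thesis using sqrt_t y1 by (simp only:) (subst ln_mult, auto)
    qed
    moreover have "ln (112 / 9 * 4 * sqrt (1 + t\<^sup>2)) \<le> 3 * ln 2 + 19 / 10"
    proof (rule const)
      have "t\<^sup>2 \<le> (1 / 4)\<^sup>2" using False tpos by (intro power_mono) auto
      then have "1 + t\<^sup>2 \<le> (26 / 25)\<^sup>2" by (simp add: power2_eq_square)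
      then have "sqrt (1 + t\<^sup>2) \<le> sqrt ((26 / 25)\<^sup>2)" by (rule real_sqrt_le_mono)
      then show "112 / 9 * 4 * sqrt (1 + t\<^sup>2) \<le> 52" by simp
    qed (use sqrt_t in auto)
    ultimately show ?thesis by (simp add: algebra_simps)
  qed
  with B H show ?thesis by linarith
qed

text \<open>Now \<open>2 * C \<le> 1 / \<sigma>\<close>, so the first minimum is
  \<open>\<epsilon>\<close>. The comparison goes coefficient by coefficient:
  \<open>1 + w\<^sup>2\<close> for \<open>ln C\<close>, \<open>w\<^sup>2\<close> for
  \<open>ln (N d)\<close>, and a numerical remainder.\<close>

lemma H_bound_local:
  assumes N: "N \<ge> 6" and d: "d \<ge> 1" and s: "\<sigma> > 0" and C: "C \<ge> 1"
    and t: "t = \<sigma> * sqrt (real N + 1)" and w: "w = 2 * C * t" and small: "w \<le> 1 / 2"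
  shows "ln (3 * C) + w\<^sup>2 / (2 * C)
      + 2 * w\<^sup>2 * ln (4 * sqrt (2 * real d * (real N + 1) / (pi * t)) / w\<^sup>2) \<le> H_bound N d \<sigma> C"
proof -
  define n where "n = real N + 1"
  have n: "n \<ge> 7" "n \<le> 7 / 6 * real N" using N by (simp_all add: n_def)
  have tpos: "t > 0" using s by (simp add: t)
  have wpos: "w > 0" using tpos C by (simp add: w)
  have st: "\<sigma> \<le> t" "\<sigma>\<^sup>2 = t\<^sup>2 / n"
  proof -
    have "\<sigma> * 1 \<le> \<sigma> * sqrt n" using s n by (intro mult_left_mono) auto
    then show "\<sigma> \<le> t" by (simp add: t n_def)
    show "\<sigma>\<^sup>2 = t\<^sup>2 / n" using n by (simp add: t n_def power_mult_distrib)
  qed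
  have tw: "t \<le> w / 2" using C tpos by (simp add: w)
  define \<epsilon> where "\<epsilon> = 1 - exp (- 1 / (2 * \<sigma>\<^sup>2))"
  define A where "A = 2 ^ (N - 1) + 1 / \<sigma> ^ (N + 1)"
  have e: "0 < \<epsilon>" "\<epsilon> < 1" using s by (simp_all add: \<epsilon>_def)
  have e_le: "1 - \<epsilon> \<le> w\<^sup>2 / 14"
  proof -
    have "1 - \<epsilon> \<le> 2 * \<sigma>\<^sup>2" unfolding \<epsilon>_def using exp_neg_inverse_le[OF s] by simp
    also have "\<dots> \<le> 2 * t\<^sup>2 / 7"
        using n divide_left_mono[of 7 n "t\<^sup>2"] unfolding st(2) by simp
    also have "t\<^sup>2 \<le> (w / 2)\<^sup>2" using tw tpos by (intro power_mono) auto
    finally show ?thesis by (simp add: power_divide)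
  qed
  have w2: "w\<^sup>2 \<le> w / 2" using mult_left_mono[OF small, of w] wpos by (simp add: power2_eq_square)
  have lnC: "ln C \<ge> 0" using C by simp
  have piw: "3 * w \<le> pi * w" using pi_gt3 wpos by simp
  have s2C: "1 / \<sigma> \<ge> 2 * C"
  proof -
    have "2 * C * \<sigma> \<le> w" unfolding w using st(1) C by (intro mult_left_mono) auto
    then show ?thesis using small s by (simp add: field_simps)
  qed
  have A: "(2 * C) ^ N \<le> A"
  proof -
    have "(2 * C) ^ N \<le> (1 / \<sigma>) ^ N" using s2C C by (intro power_mono) auto
    also have "\<dots> \<le> (1 / \<sigma>) ^ (N + 1)" using s2C C by (intro power_increasing) auto
    also have "\<dots> \<le> A" by (simp add: A_def power_divide)
    finally show ?thesis .
  qed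
  have Nd: "real N * real d \<ge> 1" using N d mult_mono[of 1 "real N" 1 "real d"] by simp
  have H: "ln C * \<epsilon> + min (\<epsilon> * ln C) (2 * pi * w * ln C) + ln (real N * real d) * w\<^sup>2 + 3 * ln 2 + 2
      \<le> H_bound N d \<sigma> C"
  proof -
    have "1 \<le> A / (2 * C) ^ N" using A C by simp
    then have 1: "min \<epsilon> (A / (2 * C) ^ N) = \<epsilon>" using e by simp
    have "C ^ N \<le> (2 * C) ^ N" using C by (intro power_mono) auto
    then have "\<epsilon> * ln C \<le> \<epsilon> / real N * (ln A - ln \<epsilon>)"
      using order_trans[OF _ A] N C e by (intro entropy_term_ge) auto
    then have 2: "min (\<epsilon> * ln C) (2 * pi * w * ln C)
        \<le> min (\<epsilon> * ln C) (min (4 * pi * \<sigma> * C * sqrt (real N + 1) * ln C)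
          (\<epsilon> / real N * (ln A - ln \<epsilon>)))"
      by (auto simp: w t mult_ac)
    have "w\<^sup>2 \<le> 4 * pi * C * t" using w2 piw wpos by (simp add: w mult_ac)
    moreover have "w\<^sup>2 \<le> 1" using w2 small by simp
    ultimately have "w\<^sup>2 \<le> min 1 (exp (- 1 / (2 * \<sigma>\<^sup>2)) + 4 * pi * C * \<sigma> * sqrt (real N + 1))"
      by (simp add: t mult.assoc add_increasing)
    then have 3: "ln (real N * real d) * w\<^sup>2
        \<le> ln (real N * real d) * min 1 (exp (- 1 / (2 * \<sigma>\<^sup>2)) + 4 * pi * C * \<sigma> * sqrt (real N + 1))"
      using Nd by (intro mult_left_mono) auto
    show ?thesis
      using add_mono[OF 2 3]
      unfolding H_bound_def Let_def \<epsilon>_def[symmetric] A_def[symmetric] 1 by linarith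
  qed
  have coef: "(1 + w\<^sup>2) * ln C \<le> ln C * \<epsilon> + min (\<epsilon> * ln C) (2 * pi * w * ln C)"
  proof -
    have "w\<^sup>2 \<le> 1 / 4" using w2 small by simp
    then have "1 + w\<^sup>2 \<le> \<epsilon> + \<epsilon>" using e_le by simp
    then have 1: "(1 + w\<^sup>2) * ln C \<le> (\<epsilon> + \<epsilon>) * ln C" using lnC by (rule mult_right_mono)
    have "1 + w\<^sup>2 \<le> \<epsilon> + 2 * pi * w" using e_le w2 piw wpos by linarith
    then have 2: "(1 + w\<^sup>2) * ln C \<le> (\<epsilon> + 2 * pi * w) * ln C" using lnC by (rule mult_right_mono)
    show ?thesis using 1 2 by (simp add: algebra_simps min_def)
  qed
  define X where "X = 4 * sqrt (2 * real d * (real N + 1) / (pi * t)) / w\<^sup>2"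
  have X: "X > 0" using tpos wpos d by (simp add: X_def add_pos_nonneg)
  have "2 * ln X = ln (X\<^sup>2)" using X by (simp add: ln_realpow)
  also have "X\<^sup>2 = 16 * (2 * real d * n / (pi * t)) / w ^ 4"
    using tpos n by (simp add: X_def n_def power_mult_distrib power_divide power_mult[symmetric])
  \<comment> \<open>Substituting \<open>t = w / (2 * C)\<close> produces the factor
    \<open>C\<close>; rounding \<open>14 / 9\<close> up to \<open>2\<close> makes the constant
    \<open>16 * 2 = 2 ^ 5\<close>. The fifth power costs at most \<open>5 / w\<close> in the
    logarithm, harmless after multiplication by \<open>w\<^sup>2\<close>.\<close>
  also have "ln \<dots> \<le> ln (real N * real d * (C * (2 / w) ^ 5))"
  proof (subst ln_le_cancel_iff)
    have "2 * real d * n / (pi * t) \<le> 2 * real d * (7 / 6 * real N) / (3 * t)"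
      using n tpos pi_gt3 by (intro frac_le mult_left_mono mult_right_mono) auto
    also have "\<dots> = 14 / 9 * (real N * real d) * C / w" using C tpos by (simp add: w)
    also have "\<dots> \<le> 2 * (real N * real d) * C / w"
      using Nd C wpos by (intro divide_right_mono mult_right_mono) auto
    finally have "16 * (2 * real d * n / (pi * t)) / w ^ 4
        \<le> 16 * (2 * (real N * real d) * C / w) / w ^ 4"
      using wpos by (intro divide_right_mono mult_left_mono) auto
    also have "\<dots> = real N * real d * (C * (2 / w) ^ 5)"
      by (simp add: power_divide power_numeral_reduce)
    finally show "16 * (2 * real d * n / (pi * t)) / w ^ 4 \<le> real N * real d * (C * (2 / w) ^ 5)" .
    show "0 < 16 * (2 * real d * n / (pi * t)) / w ^ 4" using wpos tpos n d by simp
    show "0 < real N * real d * (C * (2 / w) ^ 5)" using wpos C N d by simp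
  qed
  also have "\<dots> = ln (real N * real d) + ln C + 5 * ln (2 / w)"
    using Nd C wpos N d by (simp add: ln_mult ln_realpow)
  also have "ln (2 / w) \<le> (2 / w) / 2 + ln 2 - 1" using wpos by (intro ln_le_tangent) auto
  also have "\<dots> \<le> 1 / w" using ln_2_less_1 by simp
  finally have "2 * ln X \<le> ln (real N * real d) + ln C + 5 / w" by simp
  then have "w\<^sup>2 * (2 * ln X) \<le> w\<^sup>2 * (ln (real N * real d) + ln C + 5 / w)"
    by (rule mult_left_mono) simp
  also have "\<dots> = w\<^sup>2 * ln (real N * real d) + w\<^sup>2 * ln C + 5 * w"
    using wpos by (simp add: field_simps power2_eq_square)
  finally have main: "2 * w\<^sup>2 * ln X \<le> ln (real N * real d) * w\<^sup>2 + w\<^sup>2 * ln C + 5 * w"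
    by (simp add: mult_ac)
  have "w\<^sup>2 / (2 * C) \<le> w\<^sup>2 / 2" using C by (intro divide_left_mono) auto
  then have small_term: "w\<^sup>2 / (2 * C) \<le> 1 / 8" using w2 small by simp
  have "ln (3 * C) = ln 3 + ln C" using C by (subst ln_mult) auto
  also have "ln (3::real) \<le> ln (2 ^ 2)" by simp
  also have "ln ((2::real) ^ 2) = 2 * ln 2" by (subst ln_realpow) auto
  finally have "ln (3 * C) \<le> 2 * ln 2 + ln C" by simp
  \<comment> \<open>The remainder is \<open>2 * ln 2 + 1 / 8 + 5 / 2\<close>, which is below
    \<open>3 * ln 2 + 2\<close> as soon as \<open>ln 2 \<ge> 5 / 8\<close>.\<close>
  moreover have "ln 2 \<ge> (2 / 3 :: real)" by (rule ln2_ge_two_thirds)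
  ultimately have "ln (3 * C) + w\<^sup>2 / (2 * C) + 2 * w\<^sup>2 * ln X \<le> H_bound N d \<sigma> C"
    using main small_term small coef H by (simp add: distrib_right)
  then show ?thesis by (simp add: X_def)
qed

section \<open>Limits of the bound and conclusion\<close>

text \<open>Once \<open>s < 1 / (2 * C)\<close> the first minimum equals \<open>1 - e s\<close>,
  which tends to \<open>1\<close>. The middle one is squeezed between \<open>0\<close> and its entry
  linear in \<open>s\<close>.\<close>

lemma H_bound_small_limit:
  assumes N: "N \<ge> 1" and C: "C \<ge> 1"
  shows "((\<lambda>s. H_bound N d s C) \<longlongrightarrow> ln C + 3 * ln 2 + 2) (at_right 0)"
proof -
  define e where "e = (\<lambda>s::real. exp (- 1 / (2 * s\<^sup>2)))"
  define A where "A = (\<lambda>s::real. 2 ^ (N - 1) + 1 / s ^ (N + 1))"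
  define f where "f = (\<lambda>s. ln C * min (1 - e s) (A s / (2 * C) ^ N))"
  define g where "g = (\<lambda>s. min ((1 - e s) * ln C) (min (4 * pi * s * C * sqrt (real N + 1) * ln C)
      ((1 - e s) / real N * (ln (A s) - ln (1 - e s)))))"
  define h where "h = (\<lambda>s. ln (real N * real d) * min 1 (e s + 4 * pi * C * s * sqrt (real N + 1)))"
  have H: "H_bound N d s C = f s + g s + h s + 3 * ln 2 + 2" for s
    by (simp add: H_bound_def Let_def f_def g_def h_def e_def A_def)
  have lnC: "ln C \<ge> 0" using C by simp
  have pos: "\<forall>\<^sub>F s in at_right 0. s > (0::real)" by (rule eventually_at_right_less)
  have lim_e: "(e \<longlongrightarrow> 0) (at_right 0)" unfolding e_def by real_asymp
  have "\<forall>\<^sub>F s in at_right 0. s < 1 / (2 * C)"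
    using C by (intro order_tendstoD(2)[OF tendsto_ident_at]) auto
  then have "\<forall>\<^sub>F s in at_right 0. ln C * (1 - e s) = f s"
    using pos
  proof eventually_elim
    case (elim s)
    have s: "2 * C \<le> 1 / s" using elim C by (simp add: field_simps)
    have "(2 * C) ^ N \<le> (1 / s) ^ N" using s C by (intro power_mono) auto
    also have "\<dots> \<le> (1 / s) ^ (N + 1)" using s C by (intro power_increasing) auto
    also have "\<dots> \<le> A s" by (simp add: A_def power_divide)
    finally have "1 \<le> A s / (2 * C) ^ N" using C by simp
    moreover have "1 - e s \<le> 1" by (simp add: e_def)
    ultimately show ?case by (simp add: f_def)
  qed
  moreover have "((\<lambda>s. ln C * (1 - e s)) \<longlongrightarrow> ln C * (1 - 0)) (at_right 0)"
    by (intro tendsto_intros lim_e)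
  ultimately have f: "(f \<longlongrightarrow> ln C) (at_right 0)"
    by (auto intro: Lim_transform_eventually)
  have g: "(g \<longlongrightarrow> 0) (at_right 0)"
  proof (rule tendsto_sandwich[where f = "\<lambda>_. 0"])
    show "((\<lambda>s. 4 * pi * s * C * sqrt (real N + 1) * ln C) \<longlongrightarrow> 0) (at_right 0)"
      by (rule tendsto_eq_intros | simp)+
    show "\<forall>\<^sub>F s in at_right 0. 0 \<le> g s"
      using pos
    proof eventually_elim
      case (elim s)
      have e: "0 < 1 - e s" "1 - e s < 1" using elim by (auto simp: e_def)
      have "1 \<le> A s" using elim one_le_power[of "2::real" "N - 1"] by (simp add: A_def add_increasing2)
      then have "0 \<le> (1 - e s) / real N * (ln (A s) - ln (1 - e s))"
        using entropy_term_ge[OF e N, of 1 "A s"] by simp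
      then show ?case using elim e C lnC by (simp add: g_def)
    qed
    show "\<forall>\<^sub>F s in at_right 0. g s \<le> 4 * pi * s * C * sqrt (real N + 1) * ln C"
      by (intro always_eventually allI) (simp add: g_def)
  qed simp
  have m: "((\<lambda>s. min 1 (e s + 4 * pi * C * s * sqrt (real N + 1))) \<longlongrightarrow> min 1 (0 + 4 * pi * C * 0 * sqrt (real N + 1))) (at_right 0)"
    by (intro tendsto_intros lim_e)
  have h: "(h \<longlongrightarrow> ln (real N * real d) * 0) (at_right 0)"
    unfolding h_def using m by (intro tendsto_mult tendsto_const) simp
  have "((\<lambda>s. f s + g s + h s + 3 * ln 2 + 2) \<longlongrightarrow> ln C + 0 + ln (real N * real d) * 0 + 3 * ln 2 + 2) (at_right 0)"
    by (intro tendsto_intros f g h)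
  then show ?thesis by (simp add: H)
qed

text \<open>The first two summands are squeezed between \<open>0\<close> and
  \<open>ln C * (1 - e s)\<close>; the minimum multiplying \<open>ln (N d)\<close> lies between
  \<open>e s\<close> and \<open>1\<close>.\<close>

lemma H_bound_large_limit:
  assumes N: "N \<ge> 1" and C: "C \<ge> 1"
  shows "((\<lambda>s. H_bound N d s C) \<longlongrightarrow> ln (real N * real d) + 3 * ln 2 + 2) at_top"
proof -
  define e where "e = (\<lambda>s::real. exp (- 1 / (2 * s\<^sup>2)))"
  define A where "A = (\<lambda>s::real. 2 ^ (N - 1) + 1 / s ^ (N + 1))"
  define f where "f = (\<lambda>s. ln C * min (1 - e s) (A s / (2 * C) ^ N))"
  define g where "g = (\<lambda>s. min ((1 - e s) * ln C) (min (4 * pi * s * C * sqrt (real N + 1) * ln C)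
      ((1 - e s) / real N * (ln (A s) - ln (1 - e s)))))"
  define h where "h = (\<lambda>s. ln (real N * real d) * min 1 (e s + 4 * pi * C * s * sqrt (real N + 1)))"
  have H: "H_bound N d s C = f s + g s + h s + 3 * ln 2 + 2" for s
    by (simp add: H_bound_def Let_def f_def g_def h_def e_def A_def)
  have lnC: "ln C \<ge> 0" using C by simp
  have pos: "\<forall>\<^sub>F s in at_top. s > (0::real)" by (rule eventually_gt_at_top)
  have lim_e: "(e \<longlongrightarrow> 1) at_top" unfolding e_def by real_asymp
  have A1: "1 \<le> A s" if "s > 0" for s
    using that one_le_power[of "2::real" "N - 1"] by (simp add: A_def add_increasing2)
  have lim_le: "((\<lambda>s. ln C * (1 - e s)) \<longlongrightarrow> ln C * (1 - 1)) at_top"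
    by (intro tendsto_intros lim_e)
  have f: "(f \<longlongrightarrow> 0) at_top"
  proof (rule tendsto_sandwich[where f = "\<lambda>_. 0"])
    show "((\<lambda>s. ln C * (1 - e s)) \<longlongrightarrow> 0) at_top" using lim_le by simp
    show "\<forall>\<^sub>F s in at_top. 0 \<le> f s"
      using pos
    proof eventually_elim
      case (elim s)
      have "0 \<le> 1 - e s" "0 \<le> A s" using A1[OF elim] by (auto simp: e_def)
      then show ?case using lnC C by (simp add: f_def)
    qed
    show "\<forall>\<^sub>F s in at_top. f s \<le> ln C * (1 - e s)"
      using lnC by (intro always_eventually allI) (auto simp: f_def intro!: mult_left_mono)
  qed simp
  have g: "(g \<longlongrightarrow> 0) at_top"
  proof (rule tendsto_sandwich[where f = "\<lambda>_. 0"])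
    show "((\<lambda>s. ln C * (1 - e s)) \<longlongrightarrow> 0) at_top" using lim_le by simp
    show "\<forall>\<^sub>F s in at_top. 0 \<le> g s"
      using pos
    proof eventually_elim
      case (elim s)
      have e: "0 < 1 - e s" "1 - e s < 1" using elim by (auto simp: e_def)
      have "0 \<le> (1 - e s) / real N * (ln (A s) - ln (1 - e s))"
        using entropy_term_ge[OF e N, of 1 "A s"] A1[OF elim] by simp
      then show ?case using elim e C lnC by (simp add: g_def)
    qed
    show "\<forall>\<^sub>F s in at_top. g s \<le> ln C * (1 - e s)"
      by (intro always_eventually allI) (simp add: g_def mult.commute)
  qed simp
  have m: "((\<lambda>s. min 1 (e s + 4 * pi * C * s * sqrt (real N + 1))) \<longlongrightarrow> 1) at_top"
  proof (rule tendsto_sandwich[OF _ _ lim_e tendsto_const])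
    show "\<forall>\<^sub>F s in at_top. e s \<le> min 1 (e s + 4 * pi * C * s * sqrt (real N + 1))"
      using pos by eventually_elim (use C in \<open>auto simp: e_def\<close>)
  qed simp
  have h: "(h \<longlongrightarrow> ln (real N * real d) * 1) at_top"
    unfolding h_def using m by (intro tendsto_mult tendsto_const)
  have "((\<lambda>s. f s + g s + h s + 3 * ln 2 + 2) \<longlongrightarrow> 0 + 0 + ln (real N * real d) * 1 + 3 * ln 2 + 2) at_top"
    by (intro tendsto_intros f g h)
  then show ?thesis by (simp add: H)
qed

theorem theorem4p8:
  fixes \<Sigma> :: "(real^'n) set" and N d :: nat and p :: "real^'n \<Rightarrow> real"
    and xbar :: "real^'n" and \<sigma> :: real
  assumes dim: "CARD('n) = N + 1" and N6: "N \<ge> 6"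
    and closed: "closed \<Sigma>"
    and cone: "\<forall>x\<in>\<Sigma>. \<forall>t::real. t *\<^sub>R x \<in> \<Sigma>"
    and nonempty: "\<Sigma> \<noteq> {}"
    and nontriv: "\<Sigma> \<noteq> {0}"
    and d1: "d \<ge> 1"
    and poly: "hom_poly_deg d p"
    and zeros: "\<Sigma> \<subseteq> {x. p x = 0}"
    and xbar_sphere: "norm xbar = 1"
    and finite_cond: "cond_num \<Sigma> xbar \<noteq> \<infinity>"
    and sigma_pos: "\<sigma> > 0"
  shows "(\<integral>\<^sup>+ x. ennreal (gauss_density \<sigma> xbar x) * ln_cond_num \<Sigma> x \<partial>lborel)
           \<le> ennreal (H_bound N d \<sigma> (real_of_ereal (cond_num \<Sigma> xbar)))
      \<and> ((\<lambda>s. H_bound N d s (real_of_ereal (cond_num \<Sigma> xbar)))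
           \<longlongrightarrow> ln (real_of_ereal (cond_num \<Sigma> xbar)) + 3 * ln 2 + 2) (at_right 0)
      \<and> ((\<lambda>s. H_bound N d s (real_of_ereal (cond_num \<Sigma> xbar)))
           \<longlongrightarrow> ln (real N * real d) + 3 * ln 2 + 2) at_top"
proof -
  define C where "C = real_of_ereal (cond_num \<Sigma> xbar)"
  obtain \<beta> c where \<beta>: "sum \<beta> UNIV = d" "c \<beta> \<noteq> 0" and p: "\<And>x. p x = form_eval c d x"
    using poly unfolding hom_poly_deg_def form_eval_def by auto
  have zero: "0 \<in> \<Sigma>" using cone nonempty by (metis all_not_in_conv scaleR_zero_left)
  have dist_pos: "infdist xbar \<Sigma> > 0"
    using finite_cond infdist_nonneg[of xbar \<Sigma>] by (auto simp: cond_num_def split: if_splits)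
  then have C_eq: "C = 1 / infdist xbar \<Sigma>"
    using xbar_sphere by (simp add: C_def cond_num_def)
  have "infdist xbar \<Sigma> \<le> 1" using infdist_le[OF zero, of xbar] xbar_sphere by simp
  then have C1: "C \<ge> 1" using dist_pos by (simp add: C_eq)
  have AE: "AE x in lborel. form_eval c d x \<noteq> 0"
    by (rule AE_form_eval_nonzero[where \<beta> = \<beta>]) (use \<beta> d1 in auto)
  then have AE': "AE x in lborel. x \<notin> \<Sigma>"
    by eventually_elim (use zeros p in auto)
  define n where "n = real N + 1"
  have n: "real CARD('n) = n" "n \<ge> 1" by (simp_all add: dim n_def)
  \<comment> \<open>\<open>t\<^sup>2\<close> is the mean squared distance from the centre; both
    \<open>M\<close> and the case distinction depend on \<open>\<sigma>\<close> only through
    \<open>t\<close>.\<close>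
  define t where "t = \<sigma> * sqrt n"
  have t: "t > 0" "n * \<sigma>\<^sup>2 = t\<^sup>2" using sigma_pos n by (simp_all add: t_def power_mult_distrib)
  define M where "M = 4 * sqrt (2 * real d * n / (pi * t))"
  have M: "M > 0" using t n d1 by (simp add: M_def)
  have "2 * real d * sqrt n / (pi * \<sigma>) = 2 * real d * n / (pi * t)"
  proof -
    define q where "q = sqrt n"
    have q: "q > 0" "n = q * q" using n by (simp_all add: q_def)
    show ?thesis unfolding t_def q_def[symmetric] using q(1) by (subst q(2)) simp
  qed
  then have I: "(\<integral>\<^sup>+ x. ennreal (gauss_density \<sigma> xbar x) * ennreal (1 / sqrt (infdist x \<Sigma>)) \<partial>lborel) \<le> ennreal M"
    using nn_integral_inverse_sqrt_infdist[OF sigma_pos d1 AE closed nonempty, of xbar] zeros p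
    unfolding M_def n(1) by (metis (mono_tags, lifting) mem_Collect_eq subsetD)
  have "(\<integral>\<^sup>+ x. ennreal (gauss_density \<sigma> xbar x) * ln_cond_num \<Sigma> x \<partial>lborel) \<le> ennreal (H_bound N d \<sigma> C)"
  proof (cases "2 * C * t \<le> 1 / 2")
    case True
    define w where "w = 2 * C * t"
    have w: "w > 0" "w \<le> 1 / 2" using True t C1 by (auto simp: w_def)
    have q: "w\<^sup>2 = (2 * C)\<^sup>2 * (real CARD('n) * \<sigma>\<^sup>2)" unfolding n(1) t(2) by (simp add: w_def power_mult_distrib)
    \<comment> \<open>In this case \<open>t \<le> 1 / 4\<close> and
      \<open>w\<^sup>2 \<le> 1\<close>, so the quotient is at least \<open>4\<close>, which exceeds
      \<open>exp 1\<close>.\<close>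
    have large: "1 \<le> ln (M / w\<^sup>2)"
    proof -
      have "t \<le> w / 2" using C1 t by (simp add: w_def)
      then have t4: "t \<le> 1 / 4" using w by simp
      have "pi * t \<le> 4 * (1 / 4)" using t4 t pi_less_4 by (intro mult_mono) auto
      moreover have "1 \<le> real d * n" using d1 n mult_mono[of 1 "real d" 1 n] by simp
      ultimately have "1 \<le> 2 * real d * n / (pi * t)" using t by (simp add: field_simps)
      then have "4 \<le> M" by (simp add: M_def)
      moreover have "w\<^sup>2 \<le> 1" using w by (simp add: power_le_one)
      ultimately have "4 \<le> M / w\<^sup>2" using w M frac_le[of M 4 "w\<^sup>2" 1] by simp
      then have "exp 1 \<le> M / w\<^sup>2" using exp_le by linarith
      then show ?thesis using M w by (subst ln_ge_iff) auto
    qed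
    have "(\<integral>\<^sup>+ x. ennreal (gauss_density \<sigma> xbar x) * ln_cond_num \<Sigma> x \<partial>lborel)
        \<le> ennreal (ln (3 * C) + w\<^sup>2 / (2 * C) + 2 * w\<^sup>2 * ln (M / w\<^sup>2))"
      by (rule ln_cond_num_local_bound[OF sigma_pos closed zero AE' I xbar_sphere _ C1 M q _ large])
        (use w C_eq in auto)
    also have "\<dots> \<le> ennreal (H_bound N d \<sigma> C)"
      unfolding M_def n_def
      by (intro ennreal_leI H_bound_local N6 d1 sigma_pos C1 w) (auto simp: t_def n_def w_def)
    finally show ?thesis .
  next
    case False
    \<comment> \<open>The first term is at least \<open>ln t\<close>, which cancels the
      \<open>t\<close> in \<open>M\<^sup>2\<close>. There remains \<open>ln 16\<close> plus the
      logarithm of \<open>2 * d * n / pi\<close>, a number at least \<open>1\<close> because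
      \<open>n \<ge> 7\<close>.\<close>
    have "5 / 2 \<le> ln (1 + t\<^sup>2) / 2 + 2 * ln M"
    proof -
      have "ln ((t)\<^sup>2) \<le> ln (1 + t\<^sup>2)" using t by (subst ln_le_cancel_iff) (auto simp: add_pos_nonneg)
      then have 1: "ln t \<le> ln (1 + t\<^sup>2) / 2" using t by (simp add: ln_realpow)
      have "ln 16 + ln (2 * real d * n / (pi * t)) = ln (16 * (2 * real d * n / (pi * t)))"
        using t n d1 by (subst ln_mult) auto
      also have "16 * (2 * real d * n / (pi * t)) = M\<^sup>2" using t n by (simp add: M_def power_mult_distrib)
      also have "ln (M\<^sup>2) = 2 * ln M" using M by (simp add: ln_realpow)
      finally have 2: "2 * ln M = ln 16 + ln (2 * real d * n / (pi * t))" ..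
      have 3: "ln t + ln (2 * real d * n / (pi * t)) = ln (2 * real d * n / pi)"
      proof -
        have "2 * real d * n / pi = t * (2 * real d * n / (pi * t))" using t by simp
        then show ?thesis using t n d1 by (simp only:) (subst ln_mult, auto)
      qed
      have "1 \<le> 2 * real d * n / pi"
      proof -
        have "n \<ge> 7" using N6 by (simp add: n_def)
        then have "7 \<le> real d * n" using d1 mult_mono[of 1 "real d" 7 n] by simp
        then show ?thesis using pi_less_4 by simp
      qed
      then have 4: "0 \<le> ln (2 * real d * n / pi)" by simp
      have "ln (16::real) = ln (2 ^ 4)" by simp
      also have "\<dots> = 4 * ln 2" by (subst ln_realpow) auto
      finally have "5 / 2 \<le> ln (16::real)" using ln2_ge_two_thirds by simp
      then show ?thesis using 1 2 3 4 by linarith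
    qed
    then have "(\<integral>\<^sup>+ x. ennreal (gauss_density \<sigma> xbar x) * ln_cond_num \<Sigma> x \<partial>lborel)
        \<le> ennreal (ln (1 + t\<^sup>2) / 2 + 2 * ln M)"
      using ln_cond_num_global_bound[OF sigma_pos closed zero AE' I xbar_sphere M] unfolding n(1) t(2)
      by blast
    also have "\<dots> \<le> ennreal (H_bound N d \<sigma> C)"
      unfolding M_def n_def
      by (intro ennreal_leI H_bound_global N6 d1 sigma_pos C1) (use False in \<open>auto simp: t_def n_def\<close>)
    finally show ?thesis .
  qed
  moreover have "N \<ge> 1" using N6 by simp
  ultimately show ?thesis
    using H_bound_small_limit[OF _ C1] H_bound_large_limit[OF _ C1] unfolding C_def by blast
qed

end
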